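(* For a lattice $L$, the following are equivalent: (i) $L$ belongs to $\mathbf{SUB}(\mathcal{LO})$. (ii) $L$ satisfies the identities (HS), (U), (B), (E), and (P). (iii) There exists a lattice embedding $\varphi\colon L\hookrightarrow\prod_{i\in I}\mathbf{Co}(T_i)$, for some family $\langle T_i\mid i\in I\rangle$ of chains, which preserves the existing bounds and satisfies the following additional properties: — if $L$ is finite, then $\sum_{i\in I}|T_i|\leq|\mathrm{J}(L)|^2$; — if $L$ is subdirectly irreducible, then $I=\{0\}$ (a single chain $T_0$), $\varphi$ is atom-preserving, and, if $L$ is finite, then $|T_0|=|\mathrm{J}(L)|$; — if $L$ is finite, atomistic, and subdirectly irreducible, then $L\cong\mathbf{Co}(n)$, where $n=|\mathrm{J}(L)|$.
   Context: For a poset $P$, $\mathbf{Co}(P)$ is the lattice of all order-convex subsets of $P$, ordered by inclusion ($X\subseteq P$ is order-convex if $x\leq z\leq y$ and $x,y\in X$ imply $z\in X$). For a natural number $n$, $\mathbf{Co}(n)$ is $\mathbf{Co}$ of the $n$-element chain $\{0,1,\dots,n-1\}$. $\mathbf{SUB}(\mathcal{LO})$ is the class of all lattices that can be embedded into a lattice $\prod_{i\in I}\mathbf{Co}(T_i)$ for some family $\langle T_i\mid i\in I\rangle$ of chains (totally ordered sets). $\mathrm{J}(L)$ is the set of all (nonzero) join-irreducible elements of $L$. "Preserves the existing bounds" means that if $L$ has a least (resp. greatest) element, then $\varphi$ sends it to the least (resp. greatest) element. "Atom-preserving" means sending atoms to atoms. A lattice is atomistic if every element is a join of atoms. The identities are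 as follows ($\mathfrak{S}_3$ is the group of permutations of $\{0,1,2\}$). (U): $x\wedge(x_0\vee x_1)\wedge(x_0\vee x_2)\wedge(x_1\vee x_2)=(x\wedge x_0\wedge(x_1\vee x_2))\vee(x\wedge x_1\wedge(x_0\vee x_2))\vee(x\wedge x_2\wedge(x_0\vee x_1))$. (B): $x\wedge(a_0\vee a_1)\wedge(b_0\vee b_1)=\bigvee_{i<2}\bigl[(x\wedge a_i\wedge(b_0\vee b_1))\vee(x\wedge b_i\wedge(a_0\vee a_1))\bigr]\vee\bigvee_{i<2}\bigl[x\wedge(a_0\vee a_1)\wedge(b_0\vee b_1)\wedge(a_0\vee b_i)\wedge(a_1\vee b_{1-i})\bigr]$. (E): $x\wedge\bigwedge_{i<3}(a\vee b_i)=\bigvee_{i<3}\bigl[x\wedge b_i\wedge\bigwedge_{j\neq i}(a\vee b_j)\bigr]\vee\bigvee_{\sigma\in\mathfrak{S}_3}\bigl[x\wedge(a\vee b^*_{0,\sigma})\wedge(a\vee b^*_{1,\sigma})\wedge(a\vee b_{\sigma(2)})\bigr]$, where $b^*_{0,\sigma}=b_{\sigma(0)}\wedge(x\vee b_{\sigma(1)})$ and $b^*_{1,\sigma}=b_{\sigma(1)}\wedge(x\vee b_{\sigma(2)})\wedge(b_{\sigma(0)}\vee b_{\sigma(2)})$. (P): with $b'=b\wedge(b_0\vee b_1)$, $a\wedge(b'\vee c)\wedge(c\vee d)=(a\wedge b'\wedge(c\vee d))\vee(a\wedge d\wedge(b'\vee c))\vee\bigl[a\wedge((b'\wedge(a\vee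 d))\vee c)\wedge(c\vee d)\bigr]\vee\bigvee_{i<2}\bigl[a\wedge(b_i\vee c)\wedge((b'\wedge(a\vee b_i)\wedge(b_i\vee d))\vee c)\wedge(c\vee d)\bigr]$. (HS): with $b'=b\wedge(b_0\vee b_1)$, $a\wedge(b'\vee c)=(a\wedge b')\vee\bigvee_{i<2}\bigl[a\wedge((b\wedge b_i)\vee c)\bigr]\vee\bigvee_{i<2}\bigl[a\wedge((b'\wedge(a\vee b_i))\vee c)\wedge(b_i\vee c)\wedge(b\vee b_{1-i})\bigr]\vee\bigvee_{i<2}\bigl[a\wedge((b'\wedge(a\vee b_i))\vee c)\wedge(b_0\vee c)\wedge(b_1\vee c)\bigr]$. *)

theory Defs
  imports
    "HOL-Library.Lub_Glb"
    "HOL-Library.FuncSet"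
    "HOL-Combinatorics.Permutations"
begin

unbundle lattice_syntax

section \<open>Elements and embeddings of ordered sets\<close>

text \<open>
  An ordered set is given by a subset \<open>C\<close> of a type of class \<^class>\<open>order\<close>, with the order of that
  type. For \<open>L\<close> itself, \<open>C = UNIV\<close>. Least upper bounds and greatest lower bounds are always formed
  within \<open>C\<close>.
\<close>

definition least_of :: "'b::order set \<Rightarrow> 'b \<Rightarrow> bool"
  where "least_of C z \<longleftrightarrow> z \<in> C \<and> (\<forall>w\<in>C. z \<le> w)"

definition greatest_of :: "'b::order set \<Rightarrow> 'b \<Rightarrow> bool"
  where "greatest_of C z \<longleftrightarrow> z \<in> C \<and> (\<forall>w\<in>C. w \<le> z)"

definition atom_of :: "'b::order set \<Rightarrow> 'b \<Rightarrow> bool"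
  where "atom_of C p \<longleftrightarrow>
    p \<in> C \<and> (\<exists>z. least_of C z \<and> z < p \<and> \<not> (\<exists>w\<in>C. z < w \<and> w < p))"

definition lattice_embedding :: "'b::order set \<Rightarrow> ('a::lattice \<Rightarrow> 'b) \<Rightarrow> bool"
  where "lattice_embedding C \<phi> \<longleftrightarrow>
    inj \<phi> \<and> range \<phi> \<subseteq> C \<and>
    (\<forall>x y. isLub C {\<phi> x, \<phi> y} (\<phi> (x \<squnion> y)) \<and> isGlb C {\<phi> x, \<phi> y} (\<phi> (x \<sqinter> y)))"

definition lattice_isomorphism :: "'b::order set \<Rightarrow> ('a::lattice \<Rightarrow> 'b) \<Rightarrow> bool"
  where "lattice_isomorphism C \<phi> \<longleftrightarrow> lattice_embedding C \<phi> \<and> range \<phi> = C"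

definition preserves_existing_bounds :: "'b::order set \<Rightarrow> ('a::lattice \<Rightarrow> 'b) \<Rightarrow> bool"
  where "preserves_existing_bounds C \<phi> \<longleftrightarrow>
    (\<forall>z. least_of UNIV z \<longrightarrow> least_of C (\<phi> z)) \<and>
    (\<forall>z. greatest_of UNIV z \<longrightarrow> greatest_of C (\<phi> z))"

definition atom_preserving :: "'b::order set \<Rightarrow> ('a::lattice \<Rightarrow> 'b) \<Rightarrow> bool"
  where "atom_preserving C \<phi> \<longleftrightarrow> (\<forall>p. atom_of UNIV p \<longrightarrow> atom_of C (\<phi> p))"


section \<open>Properties of a lattice\<close>

text \<open>A lattice without least element has no element to exclude as zero.\<close>

definition join_irreducibles :: "'a::lattice set"
  where "join_irreducibles =
    {p. \<not> least_of UNIV p \<and> (\<forall>x y. p = x \<squnion> y \<longrightarrow> p = x \<or> p = y)}"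

definition atomistic :: "'a::lattice itself \<Rightarrow> bool"
  where "atomistic _ \<longleftrightarrow> (\<forall>x::'a. \<exists>A. A \<subseteq> {p. atom_of UNIV p} \<and> isLub UNIV A x)"

definition lattice_congruence :: "('a::lattice \<times> 'a) set \<Rightarrow> bool"
  where "lattice_congruence \<theta> \<longleftrightarrow>
    equiv UNIV \<theta> \<and>
    (\<forall>x y u v. (x, y) \<in> \<theta> \<longrightarrow> (u, v) \<in> \<theta> \<longrightarrow>
      (x \<squnion> u, y \<squnion> v) \<in> \<theta> \<and> (x \<sqinter> u, y \<sqinter> v) \<in> \<theta>)"

text \<open>There is a least congruence other than equality; one-element lattices are excluded.\<close>

definition subdirectly_irreducible :: "'a::lattice itself \<Rightarrow> bool"
  where "subdirectly_irreducible _ \<longleftrightarrow>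
    (\<exists>\<theta> :: ('a \<times> 'a) set. lattice_congruence \<theta> \<and> \<theta> \<noteq> Id \<and>
      (\<forall>\<psi>. lattice_congruence \<psi> \<and> \<psi> \<noteq> Id \<longrightarrow> \<theta> \<subseteq> \<psi>))"


section \<open>Lattices of order-convex subsets\<close>

definition order_convex :: "'t set \<Rightarrow> 't rel \<Rightarrow> 't set \<Rightarrow> bool"
  where "order_convex P r X \<longleftrightarrow>
    X \<subseteq> P \<and> (\<forall>x\<in>X. \<forall>y\<in>X. \<forall>z\<in>P. (x, z) \<in> r \<and> (z, y) \<in> r \<longrightarrow> z \<in> X)"

definition Co :: "'t set \<Rightarrow> 't rel \<Rightarrow> 't set set"
  where "Co P r = {X. order_convex P r X}"

definition Co_nat :: "nat \<Rightarrow> nat set set"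
  where "Co_nat n = Co {..<n} {(i, j). i \<le> j \<and> j < n}"

text \<open>
  Elements of the product are extensional functions, all equal to \<^const>\<open>undefined\<close> outside \<open>I\<close>;
  hence the pointwise order of the function type, restricted to the product, is the product order.
\<close>

definition Co_product :: "'i set \<Rightarrow> ('i \<Rightarrow> 't set) \<Rightarrow> ('i \<Rightarrow> 't rel) \<Rightarrow> ('i \<Rightarrow> 't set) set"
  where "Co_product I T r = (\<Pi>\<^sub>E i\<in>I. Co (T i) (r i))"

definition chain_family :: "'i set \<Rightarrow> ('i \<Rightarrow> 't set) \<Rightarrow> ('i \<Rightarrow> 't rel) \<Rightarrow> bool"
  where "chain_family I T r \<longleftrightarrow> (\<forall>i\<in>I. linear_order_on (T i) (r i))"

text \<open>
  Membership of the lattice \<open>'a\<close> in \<open>SUB(LO)\<close>, for families whose indices are drawn from the type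
  \<open>'i\<close> and whose chains are drawn from the type \<open>'t\<close>. A formula cannot quantify over types, so these
  two types are parameters; they have to be large enough relative to \<open>'a\<close>.
\<close>

definition in_SUB_LO :: "'a::lattice itself \<Rightarrow> 'i itself \<Rightarrow> 't itself \<Rightarrow> bool"
  where "in_SUB_LO _ _ _ \<longleftrightarrow>
    (\<exists>(I :: 'i set) (T :: 'i \<Rightarrow> 't set) (r :: 'i \<Rightarrow> 't rel) (\<phi> :: 'a \<Rightarrow> 'i \<Rightarrow> 't set).
      chain_family I T r \<and> lattice_embedding (Co_product I T r) \<phi>)"


section \<open>The identities\<close>

text \<open>Indexed families of variables are functions on \<^typ>\<open>nat\<close>, used at the indices 0, 1, 2 only.\<close>

definition identity_U :: "'a::lattice itself \<Rightarrow> bool"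
  where "identity_U _ \<longleftrightarrow> (\<forall>x x0 x1 x2 :: 'a.
    x \<sqinter> (x0 \<squnion> x1) \<sqinter> (x0 \<squnion> x2) \<sqinter> (x1 \<squnion> x2) =
      (x \<sqinter> x0 \<sqinter> (x1 \<squnion> x2)) \<squnion> (x \<sqinter> x1 \<sqinter> (x0 \<squnion> x2)) \<squnion> (x \<sqinter> x2 \<sqinter> (x0 \<squnion> x1)))"

definition identity_B :: "'a::lattice itself \<Rightarrow> bool"
  where "identity_B _ \<longleftrightarrow> (\<forall>(x :: 'a) (a :: nat \<Rightarrow> 'a) (b :: nat \<Rightarrow> 'a).
    x \<sqinter> (a 0 \<squnion> a 1) \<sqinter> (b 0 \<squnion> b 1) =
      Sup_fin ((\<lambda>i. (x \<sqinter> a i \<sqinter> (b 0 \<squnion> b 1)) \<squnion> (x \<sqinter> b i \<sqinter> (a 0 \<squnion> a 1))) ` {..<2}) \<squnion>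
      Sup_fin ((\<lambda>i. x \<sqinter> (a 0 \<squnion> a 1) \<sqinter> (b 0 \<squnion> b 1) \<sqinter> (a 0 \<squnion> b i) \<sqinter> (a 1 \<squnion> b (1 - i))) ` {..<2}))"

definition identity_E :: "'a::lattice itself \<Rightarrow> bool"
  where "identity_E _ \<longleftrightarrow> (\<forall>(x :: 'a) (a :: 'a) (b :: nat \<Rightarrow> 'a).
    x \<sqinter> Inf_fin ((\<lambda>i. a \<squnion> b i) ` {..<3}) =
      Sup_fin ((\<lambda>i. x \<sqinter> b i \<sqinter> Inf_fin ((\<lambda>j. a \<squnion> b j) ` ({..<3} - {i}))) ` {..<3}) \<squnion>
      Sup_fin ((\<lambda>\<sigma>.
        let b0 = b (\<sigma> 0) \<sqinter> (x \<squnion> b (\<sigma> 1));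
            b1 = b (\<sigma> 1) \<sqinter> (x \<squnion> b (\<sigma> 2)) \<sqinter> (b (\<sigma> 0) \<squnion> b (\<sigma> 2))
        in x \<sqinter> (a \<squnion> b0) \<sqinter> (a \<squnion> b1) \<sqinter> (a \<squnion> b (\<sigma> 2))) ` {\<sigma>. \<sigma> permutes {..<3}}))"

definition identity_P :: "'a::lattice itself \<Rightarrow> bool"
  where "identity_P _ \<longleftrightarrow> (\<forall>(a :: 'a) (b :: 'a) (c :: 'a) (d :: 'a) (bs :: nat \<Rightarrow> 'a).
    let b' = b \<sqinter> (bs 0 \<squnion> bs 1) in
    a \<sqinter> (b' \<squnion> c) \<sqinter> (c \<squnion> d) =
      (a \<sqinter> b' \<sqinter> (c \<squnion> d)) \<squnion> (a \<sqinter> d \<sqinter> (b' \<squnion> c)) \<squnion>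
      (a \<sqinter> ((b' \<sqinter> (a \<squnion> d)) \<squnion> c) \<sqinter> (c \<squnion> d)) \<squnion>
      Sup_fin ((\<lambda>i. a \<sqinter> (bs i \<squnion> c) \<sqinter> ((b' \<sqinter> (a \<squnion> bs i) \<sqinter> (bs i \<squnion> d)) \<squnion> c) \<sqinter> (c \<squnion> d)) ` {..<2}))"

definition identity_HS :: "'a::lattice itself \<Rightarrow> bool"
  where "identity_HS _ \<longleftrightarrow> (\<forall>(a :: 'a) (b :: 'a) (c :: 'a) (bs :: nat \<Rightarrow> 'a).
    let b' = b \<sqinter> (bs 0 \<squnion> bs 1) in
    a \<sqinter> (b' \<squnion> c) =
      (a \<sqinter> b') \<squnion>
      Sup_fin ((\<lambda>i. a \<sqinter> ((b \<sqinter> bs i) \<squnion> c)) ` {..<2}) \<squnion>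
      Sup_fin ((\<lambda>i. a \<sqinter> ((b' \<sqinter> (a \<squnion> bs i)) \<squnion> c) \<sqinter> (bs i \<squnion> c) \<sqinter> (b \<squnion> bs (1 - i))) ` {..<2}) \<squnion>
      Sup_fin ((\<lambda>i. a \<sqinter> ((b' \<sqinter> (a \<squnion> bs i)) \<squnion> c) \<sqinter> (bs 0 \<squnion> c) \<sqinter> (bs 1 \<squnion> c)) ` {..<2}))"

end

theory Submission
  imports Defs
begin

text \<open>
  Pass to the lattice of filters, which satisfies the same identities and has enough
  join-irreducible elements and minimal join covers. For a join-irreducible \<open>p\<close>, let the neighbours
  of \<open>p\<close> be the members of its minimal nontrivial covers \<open>p \<le> u \<squnion> v\<close>. By (U) and (B) the
  relation \<open>p \<le> u \<squnion> v\<close> is a complete bipartite graph on the neighbours, and by (HS) and (E) the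
  relation \<open>u \<le> p \<squnion> w\<close> orders each of the two sides linearly. Placing \<open>p\<close> between the two sides
  gives a chain \<open>T p\<close>, and sending \<open>x\<close> to the elements of \<open>T p\<close> below \<open>x\<close> is a homomorphism to
  \<open>Co (T p)\<close>: images are convex by (E), and joins are preserved by (HS), (P) and (U). These
  homomorphisms separate points; if the lattice is subdirectly irreducible, one of them is injective.
\<close>

text \<open>Each joinand on the right of an identity records one relative position of points in a
  chain, so in \<open>Co\<close> of a chain the identities are case distinctions. Conversely, if a
  join-irreducible \<open>p\<close> lies below the left-hand side, it equals one of the joinands, so
  an identity becomes a disjunction about \<open>p\<close>, and the order of a chain has to be
  recovered from such disjunctions. What makes them usable is minimality: if \<open>u\<close>,
  \<open>v\<close> is a minimal cover of \<open>p\<close>, then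
  \<open>p \<le> (u \<sqinter> w) \<squnion> v\<close> forces \<open>u \<le> w\<close>. An arbitrary
  lattice need not have minimal covers or join-irreducible elements. With filters ordered by reverse
  inclusion, both are maximal filters and come from Zorn's lemma. The bound \<open>|J|^2\<close>
  counts one chain for each join-irreducible element, each chain consisting of join-irreducible
  elements. For finite lattices all filters are principal, so the count refers to the given
  lattice.\<close>

section \<open>Joins, meets and permutations over small index sets\<close>

lemma lessThan_2: "{..<2::nat} = {0, 1}" and lessThan_3: "{..<3::nat} = {0, 1, 2}"
  by auto

lemma Sup_fin_2: "Sup_fin (g ` {..<2::nat}) = g 0 \<squnion> (g 1 :: 'a::lattice)"
  by (simp add: lessThan_2)

lemma Sup_fin_3: "Sup_fin (g ` {..<3::nat}) = g 0 \<squnion> (g 1 \<squnion> (g 2 :: 'a::lattice))"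
  and Inf_fin_3: "Inf_fin (g ` {..<3::nat}) = g 0 \<sqinter> (g 1 \<sqinter> (g 2 :: 'a::lattice))"
  by (simp_all add: lessThan_3)

lemma Inf_fin_3_remove:
  "Inf_fin (g ` ({..<3::nat} - {0})) = g 1 \<sqinter> (g 2 :: 'a::lattice)"
  "Inf_fin (g ` ({..<3::nat} - {1})) = g 0 \<sqinter> (g 2 :: 'a::lattice)"
  "Inf_fin (g ` ({..<3::nat} - {2})) = g 0 \<sqinter> (g 1 :: 'a::lattice)"
proof -
  have "{..<3} - {0} = {1, 2::nat}" "{..<3} - {1} = {0, 2::nat}" "{..<3} - {2} = {0, 1::nat}"
    by auto
  then show "Inf_fin (g ` ({..<3::nat} - {0})) = g 1 \<sqinter> (g 2 :: 'a::lattice)"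
    "Inf_fin (g ` ({..<3::nat} - {1})) = g 0 \<sqinter> (g 2 :: 'a::lattice)"
    "Inf_fin (g ` ({..<3::nat} - {2})) = g 0 \<sqinter> (g 1 :: 'a::lattice)"
    by simp_all
qed

lemma finite_permutes_3: "finite {\<sigma>. \<sigma> permutes {..<3::nat}}"
  by (simp add: finite_permutations)

lemma permutes_3_nonempty: "{\<sigma>. \<sigma> permutes {..<3::nat}} \<noteq> {}"
  using permutes_id by blast

lemma permutes_3_cases:
  assumes "\<sigma> permutes {..<3::nat}"
  shows "(\<sigma> 0, \<sigma> 1, \<sigma> 2) \<in> {(0, 1, 2), (0, 2, 1), (1, 0, 2), (1, 2, 0), (2, 0, 1), (2, 1, 0)}"
proof -
  have "\<sigma> i \<in> {0, 1, 2}" if "i < 3" for i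
    using permutes_in_image[OF assms, of i] that by (auto simp: lessThan_3)
  then have "\<sigma> 0 \<in> {0, 1, 2}" "\<sigma> 1 \<in> {0, 1, 2}" "\<sigma> 2 \<in> {0, 1, 2}"
    by (force simp: less_Suc_eq numeral_eq_Suc)+
  moreover have "\<sigma> 0 \<noteq> \<sigma> 1" "\<sigma> 0 \<noteq> \<sigma> 2" "\<sigma> 1 \<noteq> \<sigma> 2"
    using permutes_inj[OF assms] by (simp_all add: inj_eq)
  ultimately show ?thesis unfolding insert_iff empty_iff by (elim disjE) simp_all
qed

lemma permutes_3_exists:
  assumes "(i, j, k) \<in> {(0, 1, 2), (0, 2, 1), (1, 0, 2), (1, 2, 0), (2, 0, 1), (2, 1, 0::nat)}"
  shows "\<exists>\<sigma>. \<sigma> permutes {..<3::nat} \<and> \<sigma> 0 = i \<and> \<sigma> 1 = j \<and> \<sigma> 2 = k"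
proof -
  define \<sigma> where "\<sigma> n = (if n = 0 then i else if n = 1 then j else if n = 2 then k else n)" for n
  have "bij_betw \<sigma> {..<3} {..<3}"
    using assms by (auto simp: bij_betw_def lessThan_3 \<sigma>_def inj_on_def)
  then have "\<sigma> permutes {..<3}"
    by (rule bij_imp_permutes) (auto simp: \<sigma>_def)
  then show ?thesis by (auto simp: \<sigma>_def)
qed

section \<open>Lattices of convex subsets of chains satisfy the identities\<close>

text \<open>Models a homomorphism into the convex subsets of a chain. Convexity of the images is
  contained in \<open>mem_sup\<close>: take both arguments equal, as \<open>lo_hi_mem\<close> does.
  All assumptions are symmetric under reversal of \<open>r\<close>, so by \<open>converse\<close>
  each identity is proved for one orientation only.\<close>

locale chain_hom =
  fixes r :: "'t rel" and f :: "'a::lattice \<Rightarrow> 't set"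
  assumes linear: "linear_order_on (Field r) r"
    and subset_Field: "f x \<subseteq> Field r"
    and mem_inf [simp]: "z \<in> f (x \<sqinter> y) \<longleftrightarrow> z \<in> f x \<and> z \<in> f y"
    and mem_sup: "z \<in> f (x \<squnion> y) \<longleftrightarrow> z \<in> f x \<or> z \<in> f y \<or>
      (\<exists>u\<in>f x. \<exists>v\<in>f y. (u, z) \<in> r \<and> (z, v) \<in> r \<or> (v, z) \<in> r \<and> (z, u) \<in> r)"
begin

lemma converse: "chain_hom (r\<inverse>) f"
proof
  show "linear_order_on (Field (r\<inverse>)) (r\<inverse>)" using linear by simp
  show "f x \<subseteq> Field (r\<inverse>)" for x using subset_Field by simp
qed (simp_all only: mem_inf mem_sup converse_iff disj_commute conj_commute)

definition lo where "lo z x \<longleftrightarrow> (\<exists>u\<in>f x. (u, z) \<in> r)"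
definition hi where "hi z x \<longleftrightarrow> (\<exists>u\<in>f x. (z, u) \<in> r)"

lemma mem_sup_iff: "z \<in> f (x \<squnion> y) \<longleftrightarrow> z \<in> f x \<or> z \<in> f y \<or> lo z x \<and> hi z y \<or> lo z y \<and> hi z x"
  unfolding mem_sup lo_def hi_def by blast

lemma mem_supI1: "z \<in> f x \<Longrightarrow> z \<in> f (x \<squnion> y)"
  and mem_supI2: "z \<in> f y \<Longrightarrow> z \<in> f (x \<squnion> y)"
  and mem_infI: "z \<in> f x \<Longrightarrow> z \<in> f y \<Longrightarrow> z \<in> f (x \<sqinter> y)"
  by (simp_all add: mem_sup)

lemma lo_hi_mem: "lo z x \<Longrightarrow> hi z x \<Longrightarrow> z \<in> f x"
  using mem_sup_iff[of z x x] by simp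

lemma mem_mono: "x \<le> y \<Longrightarrow> z \<in> f x \<Longrightarrow> z \<in> f y"
  using mem_inf[of z x y] by (simp add: inf_absorb1)

lemma mem_Sup_fin: "finite S \<Longrightarrow> s \<in> S \<Longrightarrow> z \<in> f s \<Longrightarrow> z \<in> f (Sup_fin S)"
  using mem_mono Sup_fin.coboundedI by blast

lemma le_total: "z \<in> f x \<Longrightarrow> w \<in> f y \<Longrightarrow> (z, w) \<in> r \<or> (w, z) \<in> r"
  using linear subset_Field[of x] subset_Field[of y]
  by (metis linear_order_on_def partial_order_on_def preorder_on_def refl_onD subsetD total_on_def)

lemma le_trans: "(x, y) \<in> r \<Longrightarrow> (y, z) \<in> r \<Longrightarrow> (x, z) \<in> r"
  using linear by (meson linear_order_on_def partial_order_on_def preorder_on_def transD)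

text \<open>Pigeonhole: if \<open>z\<close> lies in none of the three sets, convexity keeps each of
  them on one side of \<open>z\<close>. Two of them are then on the same side, and their join misses
  \<open>z\<close>.\<close>

lemma identity_U:
  assumes "z \<in> f (x \<sqinter> (x0 \<squnion> x1) \<sqinter> (x0 \<squnion> x2) \<sqinter> (x1 \<squnion> x2))"
  shows "z \<in> f ((x \<sqinter> x0 \<sqinter> (x1 \<squnion> x2)) \<squnion> (x \<sqinter> x1 \<sqinter> (x0 \<squnion> x2)) \<squnion> (x \<sqinter> x2 \<sqinter> (x0 \<squnion> x1)))"
  using assms lo_hi_mem[of z x0] lo_hi_mem[of z x1] lo_hi_mem[of z x2]
  unfolding mem_sup_iff mem_inf by blast

text \<open>If \<open>z\<close> is in none of the four sets, it separates \<open>a 0\<close> from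
  \<open>a 1\<close> and \<open>b 0\<close> from \<open>b 1\<close>. Pairing each lower set with the
  upper one of the other pair gives the crossed joins.\<close>

lemma identity_B:
  assumes "z \<in> f (x \<sqinter> (a 0 \<squnion> a 1) \<sqinter> (b 0 \<squnion> b 1))"
  shows "z \<in> f (Sup_fin ((\<lambda>i. (x \<sqinter> a i \<sqinter> (b 0 \<squnion> b 1)) \<squnion> (x \<sqinter> b i \<sqinter> (a 0 \<squnion> a 1))) ` {..<2::nat}) \<squnion>
      Sup_fin ((\<lambda>i. x \<sqinter> (a 0 \<squnion> a 1) \<sqinter> (b 0 \<squnion> b 1) \<sqinter> (a 0 \<squnion> b i) \<sqinter> (a 1 \<squnion> b (1 - i))) ` {..<2}))"
proof -
  have *: "z \<in> f x" "z \<in> f (a 0 \<squnion> a 1)" "z \<in> f (b 0 \<squnion> b 1)"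
    using assms unfolding mem_inf by blast+
  then have "z \<in> f (a 0) \<or> z \<in> f (a 1) \<or> z \<in> f (b 0) \<or> z \<in> f (b 1) \<or>
    z \<in> f (a 0 \<squnion> b 0) \<and> z \<in> f (a 1 \<squnion> b 1) \<or> z \<in> f (a 0 \<squnion> b 1) \<and> z \<in> f (a 1 \<squnion> b 0)"
    unfolding mem_sup_iff by blast
  then show ?thesis
    using * unfolding Sup_fin_2 diff_zero diff_self_eq_0
    by (elim disjE conjE) (blast intro: mem_supI1 mem_supI2 mem_infI)+
qed

lemma three_sorted:
  assumes "\<beta> 0 \<in> f x0" "\<beta> 1 \<in> f x1" "\<beta> 2 \<in> f x2"
  shows "\<exists>\<sigma>. \<sigma> permutes {..<3::nat} \<and> (\<beta> (\<sigma> 0), \<beta> (\<sigma> 1)) \<in> r \<and> (\<beta> (\<sigma> 1), \<beta> (\<sigma> 2)) \<in> r"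
proof -
  have "?thesis" if "(\<beta> i, \<beta> j) \<in> r" "(\<beta> j, \<beta> k) \<in> r"
    "(i, j, k) \<in> {(0, 1, 2), (0, 2, 1), (1, 0, 2), (1, 2, 0), (2, 0, 1), (2, 1, 0::nat)}" for i j k
    using permutes_3_exists[OF that(3)] that(1,2) by metis
  from this[of 0 1 2] this[of 0 2 1] this[of 1 0 2] this[of 1 2 0] this[of 2 0 1] this[of 2 1 0]
  show ?thesis
    using le_total[OF assms(1,2)] le_total[OF assms(1,3)] le_total[OF assms(2,3)]
    by (elim disjE) simp_all
qed

text \<open>The permutation sorts points of the three \<open>b i\<close> by their distance from
  \<open>z\<close>. The first point then lies between \<open>z\<close> and the second, and the
  second lies between \<open>z\<close> and the third as well as between the first and the third.
  These are the memberships that the two starred terms of (E) encode.\<close>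

lemma identity_E_lo:
  fixes b :: "nat \<Rightarrow> 'a"
  assumes z: "z \<in> f x" and "lo z a" and "hi z (b 0)" "hi z (b 1)" "hi z (b 2)"
  shows "\<exists>\<sigma>. \<sigma> permutes {..<3::nat} \<and>
    z \<in> f (a \<squnion> (b (\<sigma> 0) \<sqinter> (x \<squnion> b (\<sigma> 1)))) \<and>
    z \<in> f (a \<squnion> (b (\<sigma> 1) \<sqinter> (x \<squnion> b (\<sigma> 2)) \<sqinter> (b (\<sigma> 0) \<squnion> b (\<sigma> 2)))) \<and> z \<in> f (a \<squnion> b (\<sigma> 2))"
proof -
  obtain \<beta>0 \<beta>1 \<beta>2 where *: "\<beta>0 \<in> f (b 0)" "\<beta>1 \<in> f (b 1)" "\<beta>2 \<in> f (b 2)"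
    "(z, \<beta>0) \<in> r" "(z, \<beta>1) \<in> r" "(z, \<beta>2) \<in> r"
    using assms unfolding hi_def by blast
  define \<beta> where "\<beta> n = (if n = 0 then \<beta>0 else if n = 1 then \<beta>1 else \<beta>2)" for n :: nat
  have \<beta>: "\<beta> 0 \<in> f (b 0)" "\<beta> 1 \<in> f (b 1)" "\<beta> 2 \<in> f (b 2)"
    "(z, \<beta> 0) \<in> r" "(z, \<beta> 1) \<in> r" "(z, \<beta> 2) \<in> r"
    using * by (simp_all add: \<beta>_def)
  obtain \<sigma> where \<sigma>: "\<sigma> permutes {..<3}" "(\<beta> (\<sigma> 0), \<beta> (\<sigma> 1)) \<in> r" "(\<beta> (\<sigma> 1), \<beta> (\<sigma> 2)) \<in> r"
    using three_sorted[OF \<beta>(1-3)] by blast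
  have mem: "\<beta> (\<sigma> i) \<in> f (b (\<sigma> i)) \<and> (z, \<beta> (\<sigma> i)) \<in> r" if "i \<in> {0, 1, 2}" for i
    using permutes_3_cases[OF \<sigma>(1)] \<beta> that by auto
  have 0: "\<beta> (\<sigma> 0) \<in> f (b (\<sigma> 0) \<sqinter> (x \<squnion> b (\<sigma> 1)))"
    using mem[of 0] mem[of 1] z \<sigma> by (auto simp: mem_sup)
  have 1: "\<beta> (\<sigma> 1) \<in> f (b (\<sigma> 1) \<sqinter> (x \<squnion> b (\<sigma> 2)) \<sqinter> (b (\<sigma> 0) \<squnion> b (\<sigma> 2)))"
    using mem[of 0] mem[of 1] mem[of 2] z \<sigma> by (auto simp: mem_sup)
  have "hi z (b (\<sigma> 0) \<sqinter> (x \<squnion> b (\<sigma> 1)))"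
    "hi z (b (\<sigma> 1) \<sqinter> (x \<squnion> b (\<sigma> 2)) \<sqinter> (b (\<sigma> 0) \<squnion> b (\<sigma> 2)))" "hi z (b (\<sigma> 2))"
    using 0 1 mem[of 0] mem[of 1] mem[of 2] unfolding hi_def by blast+
  then show ?thesis using \<sigma>(1) \<open>lo z a\<close> unfolding mem_sup_iff by blast
qed

lemma identity_E:
  fixes b :: "nat \<Rightarrow> 'a"
  assumes "z \<in> f (x \<sqinter> Inf_fin ((\<lambda>i. a \<squnion> b i) ` {..<3}))"
  shows "z \<in> f (Sup_fin ((\<lambda>i. x \<sqinter> b i \<sqinter> Inf_fin ((\<lambda>j. a \<squnion> b j) ` ({..<3} - {i}))) ` {..<3}) \<squnion>
      Sup_fin ((\<lambda>\<sigma>.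
        let b0 = b (\<sigma> 0) \<sqinter> (x \<squnion> b (\<sigma> 1));
            b1 = b (\<sigma> 1) \<sqinter> (x \<squnion> b (\<sigma> 2)) \<sqinter> (b (\<sigma> 0) \<squnion> b (\<sigma> 2))
        in x \<sqinter> (a \<squnion> b0) \<sqinter> (a \<squnion> b1) \<sqinter> (a \<squnion> b (\<sigma> 2))) ` {\<sigma>. \<sigma> permutes {..<3}}))"
    (is "z \<in> f (?S \<squnion> Sup_fin (?t ` _))")
proof -
  have *: "z \<in> f x" "z \<in> f (a \<squnion> b 0)" "z \<in> f (a \<squnion> b 1)" "z \<in> f (a \<squnion> b 2)"
    using assms unfolding Inf_fin_3 mem_inf by blast+
  show ?thesis
  proof (cases "z \<in> f (b 0) \<or> z \<in> f (b 1) \<or> z \<in> f (b 2)")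
    case True
    have "z \<in> f ?S"
      using * True unfolding Sup_fin_3 Inf_fin_3_remove mem_sup_iff[of z "_ \<sqinter> _"] mem_inf by blast
    then show ?thesis unfolding mem_sup_iff by blast
  next
    case False
    interpret c: chain_hom "r\<inverse>" f by (rule converse)
    have "c.lo = hi" "c.hi = lo" unfolding c.lo_def c.hi_def lo_def hi_def by auto
    then consider "z \<in> f a" | "lo z a" "hi z (b 0)" "hi z (b 1)" "hi z (b 2)"
      | "c.lo z a" "c.hi z (b 0)" "c.hi z (b 1)" "c.hi z (b 2)"
      using False *(2-4) lo_hi_mem[of z a] unfolding mem_sup_iff by auto
    then obtain \<sigma> where "\<sigma> permutes {..<3}"
      "z \<in> f (a \<squnion> (b (\<sigma> 0) \<sqinter> (x \<squnion> b (\<sigma> 1))))"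
      "z \<in> f (a \<squnion> (b (\<sigma> 1) \<sqinter> (x \<squnion> b (\<sigma> 2)) \<sqinter> (b (\<sigma> 0) \<squnion> b (\<sigma> 2))))" "z \<in> f (a \<squnion> b (\<sigma> 2))"
    proof cases
      case 1
      then show ?thesis using that[OF permutes_id] by (simp add: mem_supI1)
    next
      case 2
      then show ?thesis using that identity_E_lo[of z x a b] *(1) by blast
    next
      case 3
      then show ?thesis using that c.identity_E_lo[of z x a b] *(1) by blast
    qed
    then have "\<exists>\<sigma>. \<sigma> permutes {..<3} \<and> z \<in> f (?t \<sigma>)"
      using *(1) unfolding Let_def by (blast intro: mem_infI)
    then show ?thesis
      using mem_Sup_fin[of "?t ` {\<sigma>. \<sigma> permutes {..<3}}"] finite_permutes_3
      unfolding mem_sup_iff by blast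
  qed
qed

text \<open>Compare the two points above \<open>z\<close>. If \<open>\<beta>\<close> comes first, it
  lies between \<open>z\<close> and \<open>\<delta>\<close>. Otherwise some \<open>bs i\<close> has
  a point above \<open>\<beta>\<close>, and \<open>\<beta>\<close> lies between this point and each
  of \<open>z\<close> and \<open>\<delta>\<close>.\<close>

lemma identity_P_lo:
  fixes bs :: "nat \<Rightarrow> 'a"
  assumes z: "z \<in> f a" and \<beta>: "\<beta> \<in> f (b \<sqinter> (bs 0 \<squnion> bs 1))" "(z, \<beta>) \<in> r"
    and "lo z c" and \<delta>: "\<delta> \<in> f d" "(z, \<delta>) \<in> r"
  shows "z \<in> f (((b \<sqinter> (bs 0 \<squnion> bs 1)) \<sqinter> (a \<squnion> d)) \<squnion> c) \<or>
    (\<exists>i\<in>{0, 1}. z \<in> f (bs i \<squnion> c) \<and>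
      z \<in> f (((b \<sqinter> (bs 0 \<squnion> bs 1)) \<sqinter> (a \<squnion> bs i) \<sqinter> (bs i \<squnion> d)) \<squnion> c))"
proof -
  consider "(\<beta>, \<delta>) \<in> r" | "(\<delta>, \<beta>) \<in> r" using le_total \<beta> \<delta> by blast
  then show ?thesis
  proof cases
    case 1
    then have "\<beta> \<in> f (a \<squnion> d)" using z \<delta> \<beta> unfolding mem_sup by blast
    then have "hi z ((b \<sqinter> (bs 0 \<squnion> bs 1)) \<sqinter> (a \<squnion> d))" using \<beta> unfolding hi_def by auto
    then show ?thesis using \<open>lo z c\<close> unfolding mem_sup_iff by blast
  next
    case 2
    have "\<exists>i\<in>{0, 1}. hi \<beta> (bs i)"
      using \<beta>(1) le_total[OF \<beta>(1) \<beta>(1)] unfolding mem_inf mem_sup_iff hi_def by blast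
    then obtain i where i: "i \<in> {0, 1}" "hi \<beta> (bs i)" by blast
    have "lo \<beta> a" "lo \<beta> d" using z \<beta> 2 \<delta> unfolding lo_def by blast+
    then have "\<beta> \<in> f (a \<squnion> bs i)" "\<beta> \<in> f (bs i \<squnion> d)" using i unfolding mem_sup_iff by blast+
    then have "hi z ((b \<sqinter> (bs 0 \<squnion> bs 1)) \<sqinter> (a \<squnion> bs i) \<sqinter> (bs i \<squnion> d))"
      using \<beta> unfolding hi_def by auto
    moreover have "hi z (bs i)" using i(2) \<beta>(2) le_trans unfolding hi_def by blast
    ultimately show ?thesis using i(1) \<open>lo z c\<close> unfolding mem_sup_iff by blast
  qed
qed

lemma identity_P:
  fixes b and bs :: "nat \<Rightarrow> 'a"
  defines "b' \<equiv> b \<sqinter> (bs 0 \<squnion> bs 1)"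
  assumes "z \<in> f (a \<sqinter> (b' \<squnion> c) \<sqinter> (c \<squnion> d))"
  shows "z \<in> f ((a \<sqinter> b' \<sqinter> (c \<squnion> d)) \<squnion> (a \<sqinter> d \<sqinter> (b' \<squnion> c)) \<squnion>
      (a \<sqinter> ((b' \<sqinter> (a \<squnion> d)) \<squnion> c) \<sqinter> (c \<squnion> d)) \<squnion>
      Sup_fin ((\<lambda>i. a \<sqinter> (bs i \<squnion> c) \<sqinter> ((b' \<sqinter> (a \<squnion> bs i) \<sqinter> (bs i \<squnion> d)) \<squnion> c) \<sqinter> (c \<squnion> d)) ` {..<2}))"
proof -
  interpret c: chain_hom "r\<inverse>" f by (rule converse)
  have *: "z \<in> f a" "z \<in> f (b' \<squnion> c)" "z \<in> f (c \<squnion> d)" using assms(2) by simp_all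
  consider "z \<in> f b'" | "z \<in> f d" | "z \<in> f c" | "lo z c" "hi z b'" "hi z d" | "hi z c" "lo z b'" "lo z d"
    using *(2,3) lo_hi_mem unfolding mem_sup_iff by blast
  then have "z \<in> f b' \<or> z \<in> f d \<or> z \<in> f ((b' \<sqinter> (a \<squnion> d)) \<squnion> c) \<or>
    (\<exists>i\<in>{0, 1}. z \<in> f (bs i \<squnion> c) \<and> z \<in> f ((b' \<sqinter> (a \<squnion> bs i) \<sqinter> (bs i \<squnion> d)) \<squnion> c))"
  proof cases
    case 4
    then obtain \<beta> \<delta> where "\<beta> \<in> f b'" "(z, \<beta>) \<in> r" "\<delta> \<in> f d" "(z, \<delta>) \<in> r"
      unfolding hi_def by blast
    then show ?thesis using identity_P_lo[of z a \<beta> b bs c \<delta> d] * 4 unfolding b'_def by blast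
  next
    case 5
    then obtain \<beta> \<delta> where "\<beta> \<in> f b'" "(z, \<beta>) \<in> r\<inverse>" "\<delta> \<in> f d" "(z, \<delta>) \<in> r\<inverse>"
      unfolding lo_def by blast
    moreover have "c.lo z c" using 5 unfolding c.lo_def hi_def by auto
    ultimately show ?thesis using c.identity_P_lo[of z a \<beta> b bs c \<delta> d] * unfolding b'_def by blast
  qed (auto simp: mem_sup_iff)
  then show ?thesis
    using * unfolding Sup_fin_2 diff_zero diff_self_eq_0
    by (blast intro: mem_supI1 mem_supI2 mem_infI)
qed

text \<open>The position of \<open>z\<close> relative to a point of \<open>bs i\<close> below
  \<open>\<beta>\<close> decides between the last two families of joinands in (HS): if that point is
  below \<open>z\<close>, then \<open>z\<close> is between \<open>bs i\<close> and \<open>b\<close>,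
  otherwise between \<open>c\<close> and \<open>bs i\<close>.\<close>

lemma identity_HS_lo:
  fixes bs :: "nat \<Rightarrow> 'a"
  assumes z: "z \<in> f a" and \<beta>: "\<beta> \<in> f b" "lo \<beta> (bs i)" "hi \<beta> (bs j)" "(z, \<beta>) \<in> r" and "lo z c"
  shows "z \<in> f ((b \<sqinter> (bs i \<squnion> bs j) \<sqinter> (a \<squnion> bs j)) \<squnion> c) \<and> z \<in> f (bs j \<squnion> c) \<and>
    (z \<in> f (b \<squnion> bs i) \<or> z \<in> f (bs i \<squnion> c))"
proof -
  have "lo \<beta> a" using z \<beta> unfolding lo_def by blast
  then have "\<beta> \<in> f (b \<sqinter> (bs i \<squnion> bs j) \<sqinter> (a \<squnion> bs j))" using \<beta> by (simp add: mem_sup_iff)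
  then have "hi z (b \<sqinter> (bs i \<squnion> bs j) \<sqinter> (a \<squnion> bs j))" using \<beta>(4) unfolding hi_def by blast
  moreover have "hi z (bs j)" "hi z b" using \<beta> le_trans unfolding hi_def by blast+
  moreover have "lo z (bs i) \<or> hi z (bs i)"
    using \<beta>(2) z le_total unfolding lo_def hi_def by blast
  ultimately show ?thesis using \<open>lo z c\<close> unfolding mem_sup_iff by blast
qed

lemma identity_HS_sup_lo:
  fixes bs :: "nat \<Rightarrow> 'a"
  assumes z: "z \<in> f a" and \<beta>: "\<beta> \<in> f (b \<sqinter> (bs 0 \<squnion> bs 1))" "(z, \<beta>) \<in> r" and "lo z c"
  shows "(\<exists>i\<in>{0, 1}. z \<in> f ((b \<sqinter> bs i) \<squnion> c)) \<or>
    (\<exists>i\<in>{0, 1}. z \<in> f ((b \<sqinter> (bs 0 \<squnion> bs 1) \<sqinter> (a \<squnion> bs i)) \<squnion> c) \<and> z \<in> f (bs i \<squnion> c) \<and>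
       (z \<in> f (b \<squnion> bs (1 - i)) \<or> z \<in> f (bs (1 - i) \<squnion> c)))"
proof -
  consider i where "i \<in> {0, 1::nat}" "\<beta> \<in> f (b \<sqinter> bs i)"
    | "lo \<beta> (bs 0)" "hi \<beta> (bs 1)" | "lo \<beta> (bs 1)" "hi \<beta> (bs 0)"
    using \<beta>(1) unfolding mem_inf mem_sup_iff by blast
  then show ?thesis
  proof cases
    case 1
    then have "hi z (b \<sqinter> bs i)" using \<beta> unfolding hi_def by blast
    then show ?thesis using 1 \<open>lo z c\<close> unfolding mem_sup_iff by blast
  next
    case 2
    then show ?thesis using identity_HS_lo[of z a \<beta> b bs 0 1 c] assms by simp
  next
    case 3
    then show ?thesis using identity_HS_lo[of z a \<beta> b bs 1 0 c] assms
      by (simp add: sup_commute[of "bs (Suc 0)" "bs 0"])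
  qed
qed

lemma identity_HS:
  fixes b and bs :: "nat \<Rightarrow> 'a"
  defines "b' \<equiv> b \<sqinter> (bs 0 \<squnion> bs 1)"
  assumes "z \<in> f (a \<sqinter> (b' \<squnion> c))"
  shows "z \<in> f ((a \<sqinter> b') \<squnion>
      Sup_fin ((\<lambda>i. a \<sqinter> ((b \<sqinter> bs i) \<squnion> c)) ` {..<2}) \<squnion>
      Sup_fin ((\<lambda>i. a \<sqinter> ((b' \<sqinter> (a \<squnion> bs i)) \<squnion> c) \<sqinter> (bs i \<squnion> c) \<sqinter> (b \<squnion> bs (1 - i))) ` {..<2}) \<squnion>
      Sup_fin ((\<lambda>i. a \<sqinter> ((b' \<sqinter> (a \<squnion> bs i)) \<squnion> c) \<sqinter> (bs 0 \<squnion> c) \<sqinter> (bs 1 \<squnion> c)) ` {..<2}))"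
proof -
  interpret c: chain_hom "r\<inverse>" f by (rule converse)
  have *: "z \<in> f a" "z \<in> f (b' \<squnion> c)" using assms(2) by simp_all
  consider "z \<in> f b'" | "z \<in> f c" | "lo z c" "hi z b'" | "hi z c" "lo z b'"
    using *(2) unfolding mem_sup_iff by blast
  then have "z \<in> f b' \<or> (\<exists>i\<in>{0, 1}. z \<in> f ((b \<sqinter> bs i) \<squnion> c)) \<or>
    (\<exists>i\<in>{0, 1}. z \<in> f ((b' \<sqinter> (a \<squnion> bs i)) \<squnion> c) \<and> z \<in> f (bs i \<squnion> c) \<and>
       (z \<in> f (b \<squnion> bs (1 - i)) \<or> z \<in> f (bs (1 - i) \<squnion> c)))"
  proof cases
    case 3
    then obtain \<beta> where "\<beta> \<in> f b'" "(z, \<beta>) \<in> r" unfolding hi_def by blast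
    then show ?thesis using identity_HS_sup_lo[of z a \<beta> b bs c] * 3 unfolding b'_def by blast
  next
    case 4
    then obtain \<beta> where "\<beta> \<in> f b'" "(z, \<beta>) \<in> r\<inverse>" unfolding lo_def by blast
    moreover have "c.lo z c" using 4 unfolding c.lo_def hi_def by auto
    ultimately show ?thesis using c.identity_HS_sup_lo[of z a \<beta> b bs c] * unfolding b'_def by blast
  qed (auto simp: mem_sup_iff)
  then show ?thesis
    using * unfolding Sup_fin_2 diff_zero diff_self_eq_0
    by (elim disjE bexE conjE insertE emptyE; hypsubst?; (unfold diff_zero diff_self_eq_0)?;
        blast intro: mem_supI1 mem_supI2 mem_infI)
qed

end

section \<open>Joins and meets in \<open>Co\<close> and in its products\<close>

text \<open>For convex \<open>X\<close> and \<open>Y\<close> this is the convex hull of the union,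
  since a point between two elements of the same set already belongs to that set.\<close>

definition Co_join :: "'t rel \<Rightarrow> 't set \<Rightarrow> 't set \<Rightarrow> 't set"
  where "Co_join r X Y = X \<union> Y \<union>
    {z. \<exists>u\<in>X. \<exists>v\<in>Y. (u, z) \<in> r \<and> (z, v) \<in> r \<or> (v, z) \<in> r \<and> (z, u) \<in> r}"

lemma linear_order_onD:
  assumes "linear_order_on A r"
  shows "r \<subseteq> A \<times> A" "x \<in> A \<Longrightarrow> (x, x) \<in> r"
    "(x, y) \<in> r \<Longrightarrow> (y, z) \<in> r \<Longrightarrow> (x, z) \<in> r" "(x, y) \<in> r \<Longrightarrow> (y, x) \<in> r \<Longrightarrow> x = y"
    "x \<in> A \<Longrightarrow> y \<in> A \<Longrightarrow> (x, y) \<in> r \<or> (y, x) \<in> r"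
    "Field r = A"
proof -
  show 1: "r \<subseteq> A \<times> A" and 2: "x \<in> A \<Longrightarrow> (x, x) \<in> r" for x
    using assms by (auto simp: order_on_defs refl_on_def)
  show "(x, y) \<in> r \<Longrightarrow> (y, z) \<in> r \<Longrightarrow> (x, z) \<in> r" "(x, y) \<in> r \<Longrightarrow> (y, x) \<in> r \<Longrightarrow> x = y"
    using assms unfolding order_on_defs by (meson transD antisymD)+
  show "x \<in> A \<Longrightarrow> y \<in> A \<Longrightarrow> (x, y) \<in> r \<or> (y, x) \<in> r"
    using assms 2 unfolding order_on_defs total_on_def by metis
  show "Field r = A" using 1 2 by (auto simp: Field_def)
qed

lemma CoD: "X \<in> Co T r \<Longrightarrow> X \<subseteq> T"
  "X \<in> Co T r \<Longrightarrow> x \<in> X \<Longrightarrow> y \<in> X \<Longrightarrow> z \<in> T \<Longrightarrow> (x, z) \<in> r \<Longrightarrow> (z, y) \<in> r \<Longrightarrow> z \<in> X"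
  unfolding Co_def order_convex_def by blast+

lemma Co_inter: "X \<in> Co T r \<Longrightarrow> Y \<in> Co T r \<Longrightarrow> X \<inter> Y \<in> Co T r"
  unfolding Co_def order_convex_def by blast

lemma Co_join_in_Co:
  assumes lin: "linear_order_on T r" and X: "X \<in> Co T r" and Y: "Y \<in> Co T r"
  shows "Co_join r X Y \<in> Co T r"
proof -
  note r = linear_order_onD[OF lin]
  have "z \<in> Co_join r X Y"
    if "x \<in> Co_join r X Y" "y \<in> Co_join r X Y" "z \<in> T" "(x, z) \<in> r" "(z, y) \<in> r" for x y z
  proof -
    have "\<exists>l\<in>X \<union> Y. (l, z) \<in> r" "\<exists>h\<in>X \<union> Y. (z, h) \<in> r"
      using that r(3) unfolding Co_join_def by blast+
    then show ?thesis
      using CoD(2)[OF X] CoD(2)[OF Y] \<open>z \<in> T\<close> unfolding Co_join_def by blast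
  qed
  moreover have "Co_join r X Y \<subseteq> T"
    using CoD(1)[OF X] CoD(1)[OF Y] r(1) unfolding Co_join_def by blast
  ultimately show ?thesis unfolding Co_def order_convex_def by blast
qed

lemma Co_join_least:
  assumes "linear_order_on T r" "Z \<in> Co T r" "X \<subseteq> Z" "Y \<subseteq> Z"
  shows "Co_join r X Y \<subseteq> Z"
  using assms linear_order_onD(1)[OF assms(1)] CoD(2)[OF assms(2)] unfolding Co_join_def by blast

lemma Co_product_le_iff:
  assumes "F \<in> Co_product I T r" "G \<in> Co_product I T r"
  shows "F \<le> G \<longleftrightarrow> (\<forall>i\<in>I. F i \<subseteq> G i)"
proof -
  have "F i = G i" if "i \<notin> I" for i
    using PiE_arb[OF assms(1)[unfolded Co_product_def] that]
      PiE_arb[OF assms(2)[unfolded Co_product_def] that] by (rule trans[OF _ sym])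
  then have "F i \<subseteq> G i" if "i \<notin> I" for i using equalityD1 that by blast
  then show ?thesis unfolding le_fun_def by (cases "\<forall>i\<in>I. F i \<subseteq> G i") blast+
qed

lemma Co_product_eq_iff:
  "F \<in> Co_product I T r \<Longrightarrow> G \<in> Co_product I T r \<Longrightarrow> F = G \<longleftrightarrow> (\<forall>i\<in>I. F i = G i)"
  using PiE_ext[of F I "\<lambda>i. Co (T i) (r i)" G] unfolding Co_product_def by blast

lemma Co_product_component: "F \<in> Co_product I T r \<Longrightarrow> i \<in> I \<Longrightarrow> F i \<in> Co (T i) (r i)"
  unfolding Co_product_def by blast

lemma isLub_Co_product_iff:
  assumes lin: "chain_family I T r" and F: "F \<in> Co_product I T r" and G: "G \<in> Co_product I T r"
  shows "isLub (Co_product I T r) {F, G} H \<longleftrightarrow>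
    H \<in> Co_product I T r \<and> (\<forall>i\<in>I. H i = Co_join (r i) (F i) (G i))"
proof -
  define J where "J = (\<lambda>i\<in>I. Co_join (r i) (F i) (G i))"
  have lini: "linear_order_on (T i) (r i)" if "i \<in> I" for i
    using lin that unfolding chain_family_def by blast
  have J: "J \<in> Co_product I T r"
    unfolding Co_product_def J_def
    using Co_join_in_Co[OF lini Co_product_component[OF F] Co_product_component[OF G]] by auto
  have ub: "F \<le> J" "G \<le> J"
    unfolding Co_product_le_iff[OF F J] Co_product_le_iff[OF G J] by (auto simp: J_def Co_join_def)
  have least: "J \<le> K" if K: "K \<in> Co_product I T r" and "F \<le> K" "G \<le> K" for K
    using that(2,3) Co_join_least[OF lini Co_product_component[OF K]]
    unfolding Co_product_le_iff[OF J K] Co_product_le_iff[OF F K] Co_product_le_iff[OF G K] by (simp add: J_def)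
  have "isLub (Co_product I T r) {F, G} H \<longleftrightarrow> H \<in> Co_product I T r \<and> H = J"
    using J ub least unfolding isLub_def leastP_def isUb_def setle_def setge_def
    by (auto intro: antisym)
  then show ?thesis
    using Co_product_eq_iff[OF _ J] by (auto simp: J_def)
qed

lemma isGlb_Co_product_iff:
  assumes F: "F \<in> Co_product I T r" and G: "G \<in> Co_product I T r"
  shows "isGlb (Co_product I T r) {F, G} H \<longleftrightarrow>
    H \<in> Co_product I T r \<and> (\<forall>i\<in>I. H i = F i \<inter> G i)"
proof -
  define J where "J = (\<lambda>i\<in>I. F i \<inter> G i)"
  have J: "J \<in> Co_product I T r"
    unfolding Co_product_def J_def
    using Co_inter[OF Co_product_component[OF F] Co_product_component[OF G]] by auto
  have lb: "J \<le> F" "J \<le> G"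
    unfolding Co_product_le_iff[OF J F] Co_product_le_iff[OF J G] by (auto simp: J_def)
  have greatest: "K \<le> J" if K: "K \<in> Co_product I T r" and "K \<le> F" "K \<le> G" for K
    using that(2,3)
    unfolding Co_product_le_iff[OF K J] Co_product_le_iff[OF K F] Co_product_le_iff[OF K G] by (simp add: J_def)
  have "isGlb (Co_product I T r) {F, G} H \<longleftrightarrow> H \<in> Co_product I T r \<and> H = J"
    using J lb greatest unfolding isGlb_def greatestP_def isLb_def setle_def setge_def
    by (auto intro: antisym)
  then show ?thesis
    using Co_product_eq_iff[OF _ J] by (auto simp: J_def)
qed

lemma lattice_embedding_Co_product_iff:
  assumes "chain_family I T r"
  shows "lattice_embedding (Co_product I T r) \<phi> \<longleftrightarrow>
    inj \<phi> \<and> range \<phi> \<subseteq> Co_product I T r \<and>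
    (\<forall>i\<in>I. \<forall>x y. \<phi> (x \<squnion> y) i = Co_join (r i) (\<phi> x i) (\<phi> y i) \<and> \<phi> (x \<sqinter> y) i = \<phi> x i \<inter> \<phi> y i)"
proof (cases "range \<phi> \<subseteq> Co_product I T r")
  case True
  then have "\<phi> x \<in> Co_product I T r" for x by blast
  then show ?thesis
    using True unfolding lattice_embedding_def
    by (simp add: isLub_Co_product_iff[OF assms] isGlb_Co_product_iff) blast
next
  case False
  then show ?thesis unfolding lattice_embedding_def by blast
qed

lemma chain_hom_component:
  assumes lin: "chain_family I T r" and \<phi>: "lattice_embedding (Co_product I T r) \<phi>" and i: "i \<in> I"
  shows "chain_hom (r i) (\<lambda>x. \<phi> x i)"
proof
  have lini: "linear_order_on (T i) (r i)" using lin i unfolding chain_family_def by blast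
  then show "linear_order_on (Field (r i)) (r i)" by (simp add: linear_order_onD(6))
  have \<phi>': "\<phi> x \<in> Co_product I T r" "\<phi> (x \<squnion> y) i = Co_join (r i) (\<phi> x i) (\<phi> y i)"
    "\<phi> (x \<sqinter> y) i = \<phi> x i \<inter> \<phi> y i" for x y
    using \<phi> i unfolding lattice_embedding_Co_product_iff[OF lin] by blast+
  show "\<phi> x i \<subseteq> Field (r i)" for x
    unfolding linear_order_onD(6)[OF lini] by (rule CoD(1)[OF Co_product_component[OF \<phi>'(1) i]])
  show "z \<in> \<phi> (x \<sqinter> y) i \<longleftrightarrow> z \<in> \<phi> x i \<and> z \<in> \<phi> y i" for x y z
    by (simp add: \<phi>')
  show "z \<in> \<phi> (x \<squnion> y) i \<longleftrightarrow> z \<in> \<phi> x i \<or> z \<in> \<phi> y i \<or> (\<exists>u\<in>\<phi> x i. \<exists>v\<in>\<phi> y i.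
      (u, z) \<in> r i \<and> (z, v) \<in> r i \<or> (v, z) \<in> r i \<and> (z, u) \<in> r i)" for x y z
    by (auto simp: \<phi>' Co_join_def)
qed

section \<open>From separating families of homomorphisms to the identities\<close>

text \<open>An inequality can be tested on points of the chains, because the \<open>f i\<close>
  preserve meets and jointly separate elements. The chains enter only in one inequality of each
  identity; the reverse one holds in every lattice.\<close>

lemma identities_of_chain_homs:
  fixes f :: "'i \<Rightarrow> 'a::lattice \<Rightarrow> 't set"
  assumes hom: "\<And>i. i \<in> I \<Longrightarrow> chain_hom (r i) (f i)"
    and sep: "\<And>x y. (\<And>i. i \<in> I \<Longrightarrow> f i x = f i y) \<Longrightarrow> x = y"
  shows "identity_HS TYPE('a)" "identity_U TYPE('a)" "identity_B TYPE('a)"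
    "identity_E TYPE('a)" "identity_P TYPE('a)"
proof -
  have le: "x \<le> y" if "\<And>i z. i \<in> I \<Longrightarrow> z \<in> f i x \<Longrightarrow> z \<in> f i y" for x y
  proof -
    have "x \<sqinter> y = x"
    proof (rule sep)
      fix i assume "i \<in> I"
      then interpret chain_hom "r i" "f i" by (rule hom)
      show "f i (x \<sqinter> y) = f i x" using that \<open>i \<in> I\<close> by auto
    qed
    then show ?thesis by (simp add: le_iff_inf)
  qed
  have term_le: "a \<sqinter> (t \<squnion> c) \<le> a \<sqinter> (b \<squnion> c)" if "t \<le> b" for a b c t :: 'a
    using that by (intro inf_mono sup_mono) auto
  show "identity_HS TYPE('a)"
    unfolding identity_HS_def Let_def
  proof (intro allI antisym, goal_cases)
    case 1
    show ?case by (rule le) (rule chain_hom.identity_HS[OF hom])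
  next
    case 2
    show ?case
      unfolding Sup_fin_2 le_sup_iff
      by (intro conjI; (rule term_le | rule le_infI1, rule le_infI1, rule term_le | rule inf_mono))
        (auto intro: le_infI1 le_infI2)
  qed
  show "identity_U TYPE('a)"
    unfolding identity_U_def
  proof (intro allI antisym, goal_cases)
    case 1
    show ?case by (rule le) (rule chain_hom.identity_U[OF hom])
  next
    case 2
    show ?case
      unfolding le_sup_iff le_inf_iff by (auto intro: le_infI1 le_infI2 le_supI1 le_supI2)
  qed
  show "identity_B TYPE('a)"
    unfolding identity_B_def
  proof (intro allI antisym, goal_cases)
    case 1
    show ?case by (rule le) (rule chain_hom.identity_B[OF hom])
  next
    case 2
    show ?case
      unfolding Sup_fin_2 le_sup_iff le_inf_iff by (auto intro: le_infI1 le_infI2 le_supI1 le_supI2)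
  qed
  show "identity_P TYPE('a)"
    unfolding identity_P_def Let_def
  proof (intro allI antisym, goal_cases)
    case 1
    show ?case by (rule le) (rule chain_hom.identity_P[OF hom])
  next
    case (2 a b c d bs)
    have "a \<sqinter> (bs i \<squnion> c) \<sqinter> ((b \<sqinter> (bs 0 \<squnion> bs 1) \<sqinter> (a \<squnion> bs i) \<sqinter> (bs i \<squnion> d)) \<squnion> c) \<sqinter> (c \<squnion> d)
      \<le> a \<sqinter> (b \<sqinter> (bs 0 \<squnion> bs 1) \<squnion> c) \<sqinter> (c \<squnion> d)" for i
      by (rule inf_mono[OF inf_mono[OF inf_le1 sup_mono[OF _ order_refl]] order_refl])
        (rule le_infI1[OF inf_le1])
    moreover have "a \<sqinter> (b \<sqinter> (bs 0 \<squnion> bs 1) \<sqinter> (a \<squnion> d) \<squnion> c) \<sqinter> (c \<squnion> d)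
      \<le> a \<sqinter> (b \<sqinter> (bs 0 \<squnion> bs 1) \<squnion> c) \<sqinter> (c \<squnion> d)"
      by (intro inf_mono[OF term_le] inf_le1 order_refl)
    ultimately show ?case
      unfolding Sup_fin_2 le_sup_iff
      by (intro conjI) (auto intro: le_infI1 le_infI2 le_supI1 le_supI2)
  qed
  show "identity_E TYPE('a)"
    unfolding identity_E_def
  proof (intro allI antisym)
    fix x a :: 'a and b :: "nat \<Rightarrow> 'a"
    let ?t = "\<lambda>\<sigma>.
        let b0 = b (\<sigma> 0) \<sqinter> (x \<squnion> b (\<sigma> 1));
            b1 = b (\<sigma> 1) \<sqinter> (x \<squnion> b (\<sigma> 2)) \<sqinter> (b (\<sigma> 0) \<squnion> b (\<sigma> 2))
        in x \<sqinter> (a \<squnion> b0) \<sqinter> (a \<squnion> b1) \<sqinter> (a \<squnion> b (\<sigma> 2))"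
    let ?l = "x \<sqinter> Inf_fin ((\<lambda>i. a \<squnion> b i) ` {..<3})"
    let ?s = "Sup_fin ((\<lambda>i. x \<sqinter> b i \<sqinter> Inf_fin ((\<lambda>j. a \<squnion> b j) ` ({..<3} - {i}))) ` {..<3})"
    show "?l \<le> ?s \<squnion> Sup_fin (?t ` {\<sigma>. \<sigma> permutes {..<3}})"
      by (rule le) (rule chain_hom.identity_E[OF hom])
    have "?t \<sigma> \<le> ?l" if "\<sigma> permutes {..<3}" for \<sigma>
    proof -
      have "?t \<sigma> \<le> x \<sqinter> (a \<squnion> b (\<sigma> 0)) \<sqinter> (a \<squnion> b (\<sigma> 1)) \<sqinter> (a \<squnion> b (\<sigma> 2))"
        unfolding Let_def by (intro inf_mono sup_mono) (simp_all add: le_infI1)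
      also have "\<dots> = ?l"
        using permutes_3_cases[OF that] unfolding insert_iff empty_iff prod.inject
        by (elim disjE) (simp_all add: Inf_fin_3 inf_aci)
      finally show ?thesis .
    qed
    then have "Sup_fin (?t ` {\<sigma>. \<sigma> permutes {..<3}}) \<le> ?l"
      using finite_permutes_3 permutes_3_nonempty by (intro Sup_fin.boundedI) blast+
    moreover have "?s \<le> ?l"
      unfolding Sup_fin_3 Inf_fin_3_remove Inf_fin_3
      by (auto intro: le_infI1 le_infI2 le_supI1 le_supI2)
    ultimately show "?s \<squnion> Sup_fin (?t ` {\<sigma>. \<sigma> permutes {..<3}}) \<le> ?l" by (rule le_supI[rotated])
  qed
qed

lemma in_SUB_LO_identities:
  assumes "in_SUB_LO TYPE('a::lattice) TYPE('i) TYPE('t)"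
  shows "identity_HS TYPE('a) \<and> identity_U TYPE('a) \<and> identity_B TYPE('a) \<and>
    identity_E TYPE('a) \<and> identity_P TYPE('a)"
proof -
  obtain I :: "'i set" and T :: "'i \<Rightarrow> 't set" and r and \<phi> :: "'a \<Rightarrow> 'i \<Rightarrow> 't set"
    where lin: "chain_family I T r" and \<phi>: "lattice_embedding (Co_product I T r) \<phi>"
    using assms unfolding in_SUB_LO_def by blast
  have "x = y" if "\<And>i. i \<in> I \<Longrightarrow> \<phi> x i = \<phi> y i" for x y
    using \<phi> that Co_product_eq_iff[of "\<phi> x" I T r "\<phi> y"]
    unfolding lattice_embedding_def inj_def by blast
  from this show ?thesis
    by (intro conjI identities_of_chain_homs[where I = I and r = r and f = "\<lambda>i x. \<phi> x i"]
        chain_hom_component[OF lin \<phi>]) blast+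
qed

section \<open>Convex representations around a join-irreducible element\<close>

lemma join_irreducible_sup: "p \<in> join_irreducibles \<Longrightarrow> p = x \<squnion> y \<Longrightarrow> p = x \<or> p = y"
  unfolding join_irreducibles_def by blast

lemma join_irreducible_Sup_fin:
  assumes "finite S" "S \<noteq> {}" "p \<in> join_irreducibles" "p = Sup_fin S"
  shows "p \<in> S"
  using assms
proof (induction S rule: finite_ne_induct)
  case (insert x F)
  then show ?case using join_irreducible_sup[of p x "Sup_fin F"] by auto
qed simp

text \<open>\<open>minimal_cover\<close> is the only assumption that is not equational. It minimises
  one side of a cover; \<open>refine\<close> applies it to both sides in turn. The filter lattice
  satisfies it by \<open>filt_minimal_cover\<close>.\<close>

locale seeded_lattice =
  fixes K :: "'k::lattice itself"
  assumes identity_HS: "identity_HS K"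
    and identity_U: "identity_U K"
    and identity_B: "identity_B K"
    and identity_E: "identity_E K"
    and identity_P: "identity_P K"
    and minimal_cover: "\<And>p x y :: 'k. p \<le> x \<squnion> y \<Longrightarrow> \<exists>x'\<le>x. p \<le> x' \<squnion> y \<and> (\<forall>z<x'. \<not> p \<le> z \<squnion> y)"
begin

abbreviation J :: "'k set" where "J \<equiv> join_irreducibles"

lemmas J_sup = join_irreducible_sup[where 'a = 'k]

section \<open>The identities at a join-irreducible element\<close>

text \<open>As in the four lemmas that follow, \<open>p\<close> is substituted for the outermost
  variable: the left-hand side collapses to \<open>p\<close>, and join irreducibility selects a
  joinand on the right.\<close>

lemma J_U:
  assumes p: "p \<in> J" and "p \<le> x0 \<squnion> x1" "p \<le> x0 \<squnion> x2" "p \<le> x1 \<squnion> x2"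
  shows "p \<le> x0 \<or> p \<le> x1 \<or> p \<le> x2"
proof -
  have "p = (p \<sqinter> x0 \<sqinter> (x1 \<squnion> x2)) \<squnion> (p \<sqinter> x1 \<sqinter> (x0 \<squnion> x2)) \<squnion> (p \<sqinter> x2 \<sqinter> (x0 \<squnion> x1))"
    using identity_U[unfolded identity_U_def, rule_format, of p x0 x1 x2] assms(2-)
    by (simp add: inf_absorb1)
  from J_sup[OF p this] J_sup[OF p] show ?thesis
    by (metis inf_le1 inf_le2 order_trans)
qed

lemma J_B:
  assumes p: "p \<in> J" and "p \<le> a0 \<squnion> a1" "p \<le> b0 \<squnion> b1"
  shows "p \<le> a0 \<or> p \<le> a1 \<or> p \<le> b0 \<or> p \<le> b1 \<or>
    p \<le> a0 \<squnion> b0 \<and> p \<le> a1 \<squnion> b1 \<or> p \<le> a0 \<squnion> b1 \<and> p \<le> a1 \<squnion> b0"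
proof -
  define a b where "a = (\<lambda>i::nat. if i = 0 then a0 else a1)" and "b = (\<lambda>i::nat. if i = 0 then b0 else b1)"
  have "p \<sqinter> (a0 \<squnion> a1) \<sqinter> (b0 \<squnion> b1) = p" using assms by (simp add: inf_absorb1)
  then have "p = ((p \<sqinter> a0 \<sqinter> (b0 \<squnion> b1) \<squnion> p \<sqinter> b0 \<sqinter> (a0 \<squnion> a1)) \<squnion>
      (p \<sqinter> a1 \<sqinter> (b0 \<squnion> b1) \<squnion> p \<sqinter> b1 \<sqinter> (a0 \<squnion> a1))) \<squnion>
     (p \<sqinter> (a0 \<squnion> b0) \<sqinter> (a1 \<squnion> b1) \<squnion> p \<sqinter> (a0 \<squnion> b1) \<sqinter> (a1 \<squnion> b0))"
    using identity_B[unfolded identity_B_def, rule_format, of p a b]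
    unfolding Sup_fin_2 by (simp add: a_def b_def)
  then have "p \<in> {p \<sqinter> a0 \<sqinter> (b0 \<squnion> b1), p \<sqinter> b0 \<sqinter> (a0 \<squnion> a1), p \<sqinter> a1 \<sqinter> (b0 \<squnion> b1), p \<sqinter> b1 \<sqinter> (a0 \<squnion> a1),
      p \<sqinter> (a0 \<squnion> b0) \<sqinter> (a1 \<squnion> b1), p \<sqinter> (a0 \<squnion> b1) \<sqinter> (a1 \<squnion> b0)}"
    using J_sup[OF p] by (smt (verit) insert_iff)
  then show ?thesis by (elim insertE emptyE) (drule eq_refl, simp)+
qed

lemma J_E:
  assumes p: "p \<in> J" and le: "p \<le> a \<squnion> b0" "p \<le> a \<squnion> b1" "p \<le> a \<squnion> b2"
  shows "p \<le> b0 \<or> p \<le> b1 \<or> p \<le> b2 \<or> (\<exists>u v w. (u, v, w) \<in> {(b0, b1, b2), (b0, b2, b1), (b1, b0, b2),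
      (b1, b2, b0), (b2, b0, b1), (b2, b1, b0)} \<and>
    p \<le> a \<squnion> (u \<sqinter> (p \<squnion> v)) \<and> p \<le> a \<squnion> (v \<sqinter> (p \<squnion> w) \<sqinter> (u \<squnion> w)))"
proof -
  define b where "b = (\<lambda>i::nat. if i = 0 then b0 else if i = 1 then b1 else b2)"
  let ?t = "\<lambda>\<sigma>.
        let b0 = b (\<sigma> 0) \<sqinter> (p \<squnion> b (\<sigma> 1));
            b1 = b (\<sigma> 1) \<sqinter> (p \<squnion> b (\<sigma> 2)) \<sqinter> (b (\<sigma> 0) \<squnion> b (\<sigma> 2))
        in p \<sqinter> (a \<squnion> b0) \<sqinter> (a \<squnion> b1) \<sqinter> (a \<squnion> b (\<sigma> 2))"
  let ?s = "\<lambda>i. p \<sqinter> b i \<sqinter> Inf_fin ((\<lambda>j. a \<squnion> b j) ` ({..<3} - {i}))"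
  have "p \<sqinter> Inf_fin ((\<lambda>i. a \<squnion> b i) ` {..<3}) = p"
    using le by (simp add: Inf_fin_3 b_def inf_absorb1)
  then have "p = Sup_fin (?s ` {..<3}) \<squnion> Sup_fin (?t ` {\<sigma>. \<sigma> permutes {..<3}})"
    using identity_E[unfolded identity_E_def, rule_format, of p a b] by simp
  then consider "p = Sup_fin (?s ` {..<3})" | "p = Sup_fin (?t ` {\<sigma>. \<sigma> permutes {..<3}})"
    using J_sup[OF p] by blast
  then show ?thesis
  proof cases
    case 1
    have "p \<in> ?s ` {..<3}" by (rule join_irreducible_Sup_fin[OF _ _ p 1]) (simp_all add: lessThan_3)
    then obtain i where "i < 3" "p = ?s i" by blast
    from eq_refl[OF this(2)] have "p \<le> b i" unfolding le_inf_iff by blast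
    then show ?thesis by (auto simp: b_def split: if_splits)
  next
    case 2
    have "p \<in> ?t ` {\<sigma>. \<sigma> permutes {..<3}}"
      using finite_permutes_3 permutes_3_nonempty by (intro join_irreducible_Sup_fin[OF _ _ p 2]) simp_all
    then obtain \<sigma> where \<sigma>: "\<sigma> permutes {..<3}" "p = ?t \<sigma>" by blast
    define u v w where uvw: "u = b (\<sigma> 0)" "v = b (\<sigma> 1)" "w = b (\<sigma> 2)"
    have "p \<le> a \<squnion> (u \<sqinter> (p \<squnion> v))" "p \<le> a \<squnion> (v \<sqinter> (p \<squnion> w) \<sqinter> (u \<squnion> w))"
      using eq_refl[OF \<sigma>(2)] unfolding Let_def uvw le_inf_iff by blast+
    moreover have "(u, v, w) \<in> {(b0, b1, b2), (b0, b2, b1), (b1, b0, b2), (b1, b2, b0), (b2, b0, b1), (b2, b1, b0)}"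
      using permutes_3_cases[OF \<sigma>(1)] unfolding insert_iff empty_iff prod.inject
      by (elim disjE) (simp_all add: b_def uvw)
    ultimately show ?thesis by blast
  qed
qed

text \<open>The last hypothesis makes the \<open>b'\<close> of the identity equal to
  \<open>b\<close>. In the applications \<open>b\<close> is a neighbour of \<open>p\<close> and
  \<open>b0\<close>, \<open>b1\<close> is a cover of that neighbour; \<open>J_HS\<close> is used in
  the same way.\<close>

lemma J_P:
  assumes p: "p \<in> J" and le: "p \<le> b \<squnion> c" "p \<le> c \<squnion> d" and b: "b \<le> b0 \<squnion> b1"
  shows "p \<le> b \<or> p \<le> d \<or> p \<le> (b \<sqinter> (p \<squnion> d)) \<squnion> c \<or>
    (\<exists>u\<in>{b0, b1}. p \<le> u \<squnion> c \<and> p \<le> (b \<sqinter> (p \<squnion> u) \<sqinter> (u \<squnion> d)) \<squnion> c)"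
proof -
  define bs where "bs = (\<lambda>i::nat. if i = 0 then b0 else b1)"
  have b': "b \<sqinter> (bs 0 \<squnion> bs 1) = b" using b by (simp add: bs_def inf_absorb1)
  have "p \<sqinter> (b \<squnion> c) \<sqinter> (c \<squnion> d) = p" using le by (simp add: inf_absorb1)
  then have "p = (p \<sqinter> b \<sqinter> (c \<squnion> d)) \<squnion> (p \<sqinter> d \<sqinter> (b \<squnion> c)) \<squnion>
      (p \<sqinter> ((b \<sqinter> (p \<squnion> d)) \<squnion> c) \<sqinter> (c \<squnion> d)) \<squnion>
      (p \<sqinter> (b0 \<squnion> c) \<sqinter> ((b \<sqinter> (p \<squnion> b0) \<sqinter> (b0 \<squnion> d)) \<squnion> c) \<sqinter> (c \<squnion> d) \<squnion>
       p \<sqinter> (b1 \<squnion> c) \<sqinter> ((b \<sqinter> (p \<squnion> b1) \<sqinter> (b1 \<squnion> d)) \<squnion> c) \<sqinter> (c \<squnion> d))"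
    using identity_P[unfolded identity_P_def, rule_format, where a = p and b = b and bs = bs and c = c and d = d]
    unfolding Let_def Sup_fin_2 b' by (simp add: bs_def)
  then have "p \<in> {p \<sqinter> b \<sqinter> (c \<squnion> d), p \<sqinter> d \<sqinter> (b \<squnion> c), p \<sqinter> ((b \<sqinter> (p \<squnion> d)) \<squnion> c) \<sqinter> (c \<squnion> d),
      p \<sqinter> (b0 \<squnion> c) \<sqinter> ((b \<sqinter> (p \<squnion> b0) \<sqinter> (b0 \<squnion> d)) \<squnion> c) \<sqinter> (c \<squnion> d),
      p \<sqinter> (b1 \<squnion> c) \<sqinter> ((b \<sqinter> (p \<squnion> b1) \<sqinter> (b1 \<squnion> d)) \<squnion> c) \<sqinter> (c \<squnion> d)}"
    using J_sup[OF p] by (smt (verit) insert_iff)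
  then have "p \<le> b \<or> p \<le> d \<or> p \<le> (b \<sqinter> (p \<squnion> d)) \<squnion> c \<or>
    p \<le> b0 \<squnion> c \<and> p \<le> (b \<sqinter> (p \<squnion> b0) \<sqinter> (b0 \<squnion> d)) \<squnion> c \<or>
    p \<le> b1 \<squnion> c \<and> p \<le> (b \<sqinter> (p \<squnion> b1) \<sqinter> (b1 \<squnion> d)) \<squnion> c"
    by (elim insertE emptyE) (drule eq_refl, simp)+
  then show ?thesis by blast
qed

lemma J_HS:
  assumes p: "p \<in> J" and le: "p \<le> b \<squnion> c" and b: "b \<le> b0 \<squnion> b1"
  shows "p \<le> b \<or> (\<exists>u\<in>{b0, b1}. p \<le> (b \<sqinter> u) \<squnion> c) \<or>
    (\<exists>u v. (u, v) \<in> {(b0, b1), (b1, b0)} \<and> p \<le> (b \<sqinter> (p \<squnion> u)) \<squnion> c \<and> p \<le> u \<squnion> c \<and> (p \<le> b \<squnion> v \<or> p \<le> v \<squnion> c))"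
proof -
  define bs where "bs = (\<lambda>i::nat. if i = 0 then b0 else b1)"
  have b': "b \<sqinter> (bs 0 \<squnion> bs 1) = b" using b by (simp add: bs_def inf_absorb1)
  have "p \<sqinter> (b \<squnion> c) = p" using le by (simp add: inf_absorb1)
  then have "p = (p \<sqinter> b) \<squnion> (p \<sqinter> ((b \<sqinter> b0) \<squnion> c) \<squnion> p \<sqinter> ((b \<sqinter> b1) \<squnion> c)) \<squnion>
      (p \<sqinter> ((b \<sqinter> (p \<squnion> b0)) \<squnion> c) \<sqinter> (b0 \<squnion> c) \<sqinter> (b \<squnion> b1) \<squnion>
       p \<sqinter> ((b \<sqinter> (p \<squnion> b1)) \<squnion> c) \<sqinter> (b1 \<squnion> c) \<sqinter> (b \<squnion> b0)) \<squnion>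
      (p \<sqinter> ((b \<sqinter> (p \<squnion> b0)) \<squnion> c) \<sqinter> (b0 \<squnion> c) \<sqinter> (b1 \<squnion> c) \<squnion>
       p \<sqinter> ((b \<sqinter> (p \<squnion> b1)) \<squnion> c) \<sqinter> (b0 \<squnion> c) \<sqinter> (b1 \<squnion> c))"
    using identity_HS[unfolded identity_HS_def, rule_format, where a = p and b = b and bs = bs and c = c]
    unfolding Let_def Sup_fin_2 b' by (simp add: bs_def)
  then have "p \<in> {p \<sqinter> b, p \<sqinter> ((b \<sqinter> b0) \<squnion> c), p \<sqinter> ((b \<sqinter> b1) \<squnion> c),
      p \<sqinter> ((b \<sqinter> (p \<squnion> b0)) \<squnion> c) \<sqinter> (b0 \<squnion> c) \<sqinter> (b \<squnion> b1),
      p \<sqinter> ((b \<sqinter> (p \<squnion> b1)) \<squnion> c) \<sqinter> (b1 \<squnion> c) \<sqinter> (b \<squnion> b0),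
      p \<sqinter> ((b \<sqinter> (p \<squnion> b0)) \<squnion> c) \<sqinter> (b0 \<squnion> c) \<sqinter> (b1 \<squnion> c),
      p \<sqinter> ((b \<sqinter> (p \<squnion> b1)) \<squnion> c) \<sqinter> (b0 \<squnion> c) \<sqinter> (b1 \<squnion> c)}"
    using J_sup[OF p] by (smt (verit) insert_iff)
  then have "p \<le> b \<or> p \<le> (b \<sqinter> b0) \<squnion> c \<or> p \<le> (b \<sqinter> b1) \<squnion> c \<or>
    p \<le> (b \<sqinter> (p \<squnion> b0)) \<squnion> c \<and> p \<le> b0 \<squnion> c \<and> (p \<le> b \<squnion> b1 \<or> p \<le> b1 \<squnion> c) \<or>
    p \<le> (b \<sqinter> (p \<squnion> b1)) \<squnion> c \<and> p \<le> b1 \<squnion> c \<and> (p \<le> b \<squnion> b0 \<or> p \<le> b0 \<squnion> c)"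
    by (elim insertE emptyE) (drule eq_refl, simp)+
  then show ?thesis by blast
qed

section \<open>Minimal covers and the graph of neighbours\<close>

definition cov :: "'k \<Rightarrow> 'k \<Rightarrow> 'k \<Rightarrow> bool" where
  "cov p u v \<longleftrightarrow> p \<in> J \<and> u \<in> J \<and> v \<in> J \<and> p \<le> u \<squnion> v \<and> \<not> p \<le> u \<and> \<not> p \<le> v \<and>
    (\<forall>z<u. \<not> p \<le> z \<squnion> v) \<and> (\<forall>z<v. \<not> p \<le> u \<squnion> z)"

definition nbr :: "'k \<Rightarrow> 'k set" where "nbr p = {u. \<exists>v. cov p u v}"

lemma cov_sym: "cov p u v \<Longrightarrow> cov p v u"
  unfolding cov_def by (simp add: sup_commute)

lemma cov_minimal1: "cov p u v \<Longrightarrow> z \<le> u \<Longrightarrow> p \<le> z \<squnion> v \<Longrightarrow> z = u"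
  unfolding cov_def by (auto simp: le_less)

lemma cov_minimal2: "cov p u v \<Longrightarrow> z \<le> v \<Longrightarrow> p \<le> u \<squnion> z \<Longrightarrow> z = v"
  unfolding cov_def by (auto simp: le_less)

text \<open>The main use of minimality: it turns the inequalities for \<open>p\<close> that the
  identities produce into inequalities between neighbours.\<close>

lemma cov_le_left: "cov p u v \<Longrightarrow> p \<le> (u \<sqinter> w) \<squnion> v \<Longrightarrow> u \<le> w"
  using cov_minimal1[of p u v "u \<sqinter> w"] by (metis inf_le1 inf_le2)

lemma covD:
  assumes "cov p u v"
  shows "p \<in> J" "u \<in> J" "v \<in> J" "p \<le> u \<squnion> v" "\<not> p \<le> u" "\<not> p \<le> v" "u \<in> nbr p" "v \<in> nbr p"
  using assms cov_sym[OF assms] unfolding cov_def nbr_def by blast+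

lemma nbrD: "u \<in> nbr p \<Longrightarrow> p \<in> J" "u \<in> nbr p \<Longrightarrow> u \<in> J" "u \<in> nbr p \<Longrightarrow> \<not> p \<le> u"
  unfolding nbr_def cov_def by blast+

text \<open>If \<open>u\<close> were the join of two smaller elements, (HS) at \<open>p\<close> with
  this decomposition of \<open>u\<close> would put \<open>p\<close> below \<open>u\<close> itself or
  below the join of \<open>c\<close> with one of the smaller elements, against minimality.\<close>

lemma minimal_cover_J:
  assumes p: "p \<in> J" and "p \<le> u \<squnion> c" "\<not> p \<le> u" "\<not> p \<le> c" and min: "\<forall>z<u. \<not> p \<le> z \<squnion> c"
  shows "u \<in> J"
proof -
  have "\<not> least_of UNIV u"
    using assms(2,4) unfolding least_of_def by (metis UNIV_I sup_absorb2)
  moreover have "u = x \<or> u = y" if u: "u = x \<squnion> y" for x y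
  proof (rule ccontr)
    assume "\<not> ?thesis"
    then have "x < u" "y < u" using u by (metis less_le sup_ge1, metis less_le sup_ge2)
    then have "\<not> p \<le> x \<squnion> c" "\<not> p \<le> y \<squnion> c" "u \<sqinter> x = x" "u \<sqinter> y = y"
      using min by (auto simp: inf_absorb2)
    then show False
      using J_HS[OF p assms(2), of x y] u assms(3) by auto
  qed
  ultimately show ?thesis unfolding join_irreducibles_def by blast
qed

text \<open>Minimise the left side against \<open>y\<close>, then the right side against the result.
  The left side stays minimal because its partner has only become smaller.\<close>

lemma refine:
  assumes p: "p \<in> J" and "p \<le> x \<squnion> y" and nle: "\<not> p \<le> x" "\<not> p \<le> y"
  obtains u v where "u \<le> x" "v \<le> y" "cov p u v"
proof -
  obtain u where u: "u \<le> x" "p \<le> u \<squnion> y" "\<forall>z<u. \<not> p \<le> z \<squnion> y"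
    using minimal_cover assms(2) by blast
  have "p \<le> y \<squnion> u" using u(2) by (simp add: sup_commute)
  then obtain v where v: "v \<le> y" "p \<le> v \<squnion> u" "\<forall>z<v. \<not> p \<le> z \<squnion> u"
    using minimal_cover by blast
  have u': "\<forall>z<u. \<not> p \<le> z \<squnion> v"
    using u(3) v(1) by (meson order_trans sup_mono order_refl)
  have "\<not> p \<le> u" "\<not> p \<le> v" using nle u(1) v(1) order_trans by blast+
  then have "u \<in> J" "v \<in> J"
    using minimal_cover_J[OF p _ _ _ u'] minimal_cover_J[OF p v(2) _ _ v(3)] v(2)
    by (simp_all add: sup_commute)
  with \<open>\<not> p \<le> u\<close> \<open>\<not> p \<le> v\<close> have "cov p u v"
    using p u' v unfolding cov_def by (simp add: sup_commute)
  with u v that show thesis by blast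
qed

text \<open>
  The graph on \<open>nbr p\<close> with edges \<open>p \<le> u \<squnion> v\<close> has no triangle by (U) and no two disjoint edges
  without a connecting one by (B), hence it is complete bipartite.
\<close>

lemma nbr_triangle_free:
  "u \<in> nbr p \<Longrightarrow> v \<in> nbr p \<Longrightarrow> w \<in> nbr p \<Longrightarrow> p \<le> u \<squnion> v \<Longrightarrow> p \<le> u \<squnion> w \<Longrightarrow> \<not> p \<le> v \<squnion> w"
  using J_U[of p u v w] nbrD by blast

lemma nbr_bipartite:
  assumes u: "u \<in> nbr p" and v: "v \<in> nbr p" and w: "w \<in> nbr p" and uv: "p \<le> u \<squnion> v"
  shows "p \<le> w \<squnion> u \<longleftrightarrow> \<not> p \<le> w \<squnion> v"
proof -
  obtain w' where w': "cov p w w'" using w unfolding nbr_def by blast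
  note p = covD(1)[OF w']
  have "p \<le> u \<squnion> w \<or> p \<le> v \<squnion> w"
    using J_B[OF p uv covD(4)[OF w']] nbrD(3)[OF u] nbrD(3)[OF v] covD(5,6)[OF w'] by blast
  then show ?thesis
    using nbr_triangle_free[OF w u v] uv by (auto simp: sup_commute)
qed

text \<open>A neighbour \<open>u\<close> is minimal only relative to its own partner
  \<open>v1\<close>. If \<open>z < u\<close> still covered \<open>p\<close> with \<open>v\<close>,
  some neighbour \<open>z'\<close> below \<open>z\<close> would be adjacent to \<open>v\<close>,
  hence to \<open>v1\<close>, which is on the same side as \<open>v\<close>; minimality against
  \<open>v1\<close> then gives \<open>z' = u\<close>, which is impossible.\<close>

lemma cov_iff_nbr: "cov p u v \<longleftrightarrow> u \<in> nbr p \<and> v \<in> nbr p \<and> p \<le> u \<squnion> v"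
proof
  assume *: "u \<in> nbr p \<and> v \<in> nbr p \<and> p \<le> u \<squnion> v"
  have min: "\<not> p \<le> z \<squnion> v" if prem: "u \<in> nbr p" "v \<in> nbr p" "p \<le> u \<squnion> v" "z < u" for u v z
  proof
    assume "p \<le> z \<squnion> v"
    moreover have "\<not> p \<le> z" using nbrD(3)[OF prem(1)] prem(4) by (meson less_imp_le order_trans)
    ultimately obtain z' v' where z': "z' \<le> z" "v' \<le> v" "cov p z' v'"
      using refine[OF nbrD(1)[OF prem(1)] _ _ nbrD(3)[OF prem(2)]] by blast
    obtain v1 where v1: "cov p u v1" using prem(1) unfolding nbr_def by blast
    have "p \<le> z' \<squnion> v" using covD(4)[OF z'(3)] z'(2) by (meson order_trans sup_mono order_refl)
    moreover have "\<not> p \<le> v1 \<squnion> v"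
      using nbr_bipartite[OF prem(1,2) covD(8)[OF v1] prem(3)] covD(4)[OF v1] by (simp add: sup_commute)
    ultimately have "p \<le> v1 \<squnion> z'"
      using nbr_bipartite[OF covD(7)[OF z'(3)] prem(2) covD(8)[OF v1]] by blast
    then have "z' = u"
      using cov_minimal1[OF v1, of z'] z'(1) prem(4) by (simp add: sup_commute)
    then show False using z'(1) prem(4) by simp
  qed
  show "cov p u v"
    using * min[of u v] min[of v u] nbrD[of u p] nbrD[of v p] unfolding cov_def
    by (auto simp: sup_commute)
qed (blast dest: covD)

definition T :: "'k \<Rightarrow> 'k set" where "T p = insert p (nbr p)"

section \<open>The linear order on one side of the graph\<close>

text \<open>Here (HS) is applied at \<open>u\<close> instead of \<open>p\<close>, to
  \<open>u \<le> w \<squnion> a\<close> with \<open>w \<le> a \<squnion> u\<close>. As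
  \<open>u\<close> is not below \<open>a\<close>, the alternatives left are \<open>u \<le> w\<close>
  and \<open>u \<le> (w \<sqinter> u) \<squnion> a\<close>; the latter implies the former by
  minimality of \<open>u\<close> as part of a cover of \<open>p\<close>.\<close>

lemma cov_antisym:
  assumes u: "cov p u a" and w: "cov p w a" and le: "u \<le> a \<squnion> w" "w \<le> a \<squnion> u"
  shows "u = w"
proof -
  have "u \<le> w" if u: "cov p u a" and le: "u \<le> a \<squnion> w" "w \<le> a \<squnion> u" for u w
  proof -
    have "\<not> u \<le> a" using covD(4,6)[OF u] by (auto simp: sup_absorb2)
    moreover have "u \<le> w" if "u \<le> w \<sqinter> u \<squnion> a"
    proof -
      have "p \<le> (u \<sqinter> w) \<squnion> a"
        using covD(4)[OF u] that by (metis inf_commute le_sup_iff order_trans sup_ge2)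
      then show ?thesis by (rule cov_le_left[OF u])
    qed
    moreover have "u \<le> w \<squnion> a" using le by (simp add: sup_commute)
    moreover have "(w \<sqinter> a) \<squnion> a = a" by (simp add: sup_absorb2)
    ultimately show ?thesis
      using J_HS[OF covD(2)[OF u] _ le(2), of a] by auto
  qed
  from this[OF u le] this[OF w le(2,1)] show ?thesis by (rule antisym)
qed

text \<open>(E) at \<open>p\<close>, with the common partner \<open>a\<close> then cancelled by
  \<open>cov_le_left\<close>. A repeated neighbour yields totality, three neighbours yield
  betweenness.\<close>

lemma side_chain:
  assumes u: "cov p u a" and v: "cov p v a" and w: "cov p w a"
  shows "\<exists>x y z. (x, y, z) \<in> {(u, v, w), (u, w, v), (v, u, w), (v, w, u), (w, u, v), (w, v, u)} \<and>
    x \<le> p \<squnion> y \<and> y \<le> p \<squnion> z \<and> y \<le> x \<squnion> z"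
proof -
  have "p \<le> a \<squnion> u" "p \<le> a \<squnion> v" "p \<le> a \<squnion> w"
    using covD(4)[OF u] covD(4)[OF v] covD(4)[OF w] by (simp_all add: sup_commute)
  from J_E[OF covD(1)[OF u] this] covD(5)[OF u] covD(5)[OF v] covD(5)[OF w]
  obtain x y z where xyz: "(x, y, z) \<in> {(u, v, w), (u, w, v), (v, u, w), (v, w, u), (w, u, v), (w, v, u)}"
      "p \<le> a \<squnion> (x \<sqinter> (p \<squnion> y))" "p \<le> a \<squnion> (y \<sqinter> (p \<squnion> z) \<sqinter> (x \<squnion> z))"
    by blast
  have "x \<in> {u, v, w}" "y \<in> {u, v, w}" using xyz(1) by blast+
  then have "cov p x a" "cov p y a" using u v w by blast+
  then have "x \<le> p \<squnion> y" "y \<le> (p \<squnion> z) \<sqinter> (x \<squnion> z)"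
    using cov_le_left[of p x a "p \<squnion> y"] cov_le_left[of p y a "(p \<squnion> z) \<sqinter> (x \<squnion> z)"] xyz(2,3)
    by (simp_all only: sup_commute[of _ a] inf_assoc)
  then show ?thesis using xyz(1) unfolding le_inf_iff by blast
qed

lemma side_total: "cov p u a \<Longrightarrow> cov p w a \<Longrightarrow> u \<le> p \<squnion> w \<or> w \<le> p \<squnion> u"
  using side_chain[of p u a w w] by blast

text \<open>Since \<open>p\<close> is below \<open>a \<squnion> u\<close> and
  \<open>a \<squnion> w\<close>, joins with \<open>p\<close> may be replaced by joins with
  \<open>a\<close>.\<close>

lemma side_antisym:
  assumes u: "cov p u a" and w: "cov p w a" and le: "u \<le> p \<squnion> w" "w \<le> p \<squnion> u"
  shows "u = w"
proof (rule cov_antisym[OF u w])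
  have "p \<squnion> w \<le> a \<squnion> w" "p \<squnion> u \<le> a \<squnion> u"
    using covD(4)[OF u] covD(4)[OF w] by (auto simp: sup_commute)
  then show "u \<le> a \<squnion> w" "w \<le> a \<squnion> u" using le order_trans by blast+
qed

lemma side_trans: "u \<le> p \<squnion> v \<Longrightarrow> v \<le> p \<squnion> w \<Longrightarrow> u \<le> p \<squnion> w" for u :: 'k
  by (metis le_sup_iff order_trans sup_ge1)

text \<open>If \<open>v\<close> is not the middle term found by \<open>side_chain\<close>, the order
  found there and the assumed one together force \<open>v\<close> to equal \<open>u\<close> or
  \<open>w\<close>.\<close>

lemma side_between:
  assumes u: "cov p u a" and v: "cov p v a" and w: "cov p w a" and le: "u \<le> p \<squnion> v" "v \<le> p \<squnion> w"
  shows "v \<le> u \<squnion> w"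
proof -
  consider "v \<le> u \<squnion> w" | "w \<le> p \<squnion> v" | "v \<le> p \<squnion> u"
    using side_chain[OF u v w] side_trans le unfolding sup_commute[of w u] by blast
  then show ?thesis
    using side_antisym[OF v w] side_antisym[OF u v] le by cases auto
qed

end

section \<open>The chain around a join-irreducible element\<close>

context seeded_lattice
begin

text \<open>An arbitrary neighbour fixes which side is called low, namely the one opposite to it.
  The other choice would reverse the chain and leave its convex subsets unchanged.\<close>

definition low :: "'k \<Rightarrow> 'k set"
  where "low p = {u \<in> nbr p. p \<le> (SOME v. v \<in> nbr p) \<squnion> u}"

lemma edge_iff_low:
  assumes u: "u \<in> nbr p" and v: "v \<in> nbr p"
  shows "p \<le> u \<squnion> v \<longleftrightarrow> (u \<in> low p) \<noteq> (v \<in> low p)"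
proof -
  define s where "s = (SOME v. v \<in> nbr p)"
  have s: "s \<in> nbr p" unfolding s_def using u by (rule someI)
  have low: "w \<in> low p \<longleftrightarrow> p \<le> s \<squnion> w" if "w \<in> nbr p" for w
    using that unfolding low_def s_def by blast
  \<comment> \<open>\<open>nbr_bipartite\<close> starts from an edge. When \<open>u\<close> and
    \<open>v\<close> are not adjacent, the edge from \<open>u\<close> to its partner takes the place
    of the missing one.\<close>
  obtain u' where "cov p u u'" using u unfolding nbr_def by blast
  note u' = covD(8,4)[OF this]
  show ?thesis
    using nbr_bipartite[OF u v s] nbr_bipartite[OF u u'(1) s u'(2)] nbr_bipartite[OF u u'(1) v u'(2)]
      nbr_bipartite[OF v u'(1) s]
    by (auto simp: low[OF u] low[OF v] sup_commute)
qed

lemma cov_low: "cov p u v \<Longrightarrow> u \<in> low p \<longleftrightarrow> v \<notin> low p"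
  using edge_iff_low[of u p v] covD[of p u v] by blast

lemma covI_low: "u \<in> nbr p \<Longrightarrow> v \<in> nbr p \<Longrightarrow> (u \<in> low p) \<noteq> (v \<in> low p) \<Longrightarrow> cov p u v"
  using edge_iff_low[of u p v] cov_iff_nbr by blast

text \<open>The results on one side are stated for neighbours sharing a partner \<open>a\<close>. By
  complete bipartiteness, a partner of one neighbour serves its whole side.\<close>

lemma common_partner:
  assumes "u \<in> nbr p" "v \<in> nbr p" "w \<in> nbr p"
    and "(u \<in> low p) = (v \<in> low p)" "(u \<in> low p) = (w \<in> low p)"
  obtains a where "cov p u a" "cov p v a" "cov p w a"
proof -
  obtain a where a: "cov p u a" using assms(1) unfolding nbr_def by blast
  then have "cov p v a" "cov p w a"
    using assms covI_low[OF _ covD(8)[OF a]] cov_low[OF a] by blast+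
  with a that show thesis by blast
qed

lemma self_notin_nbr: "p \<notin> nbr p" using nbrD(3)[of p p] by blast

lemma low_subset_nbr: "low p \<subseteq> nbr p" unfolding low_def by blast

text \<open>
  The chain consists of \<open>low p\<close>, then \<open>p\<close>, then the other neighbours of \<open>p\<close>. On either side,
  \<open>u \<le> p \<squnion> w\<close> says that \<open>u\<close> is not further away from \<open>p\<close> than \<open>w\<close>.
\<close>

definition ord :: "'k \<Rightarrow> 'k rel" where
  "ord p = {(x, y). x \<in> T p \<and> y \<in> T p \<and>
    (x \<in> low p \<and> (y \<in> low p \<longrightarrow> y \<le> p \<squnion> x) \<or>
     x \<notin> low p \<and> y \<notin> low p \<and> (x = p \<or> y \<noteq> p \<and> x \<le> p \<squnion> y))}"

lemma T_cases:
  assumes "x \<in> T p"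
  obtains "x = p" "x \<notin> low p" "x \<notin> nbr p" | "x \<noteq> p" "x \<in> nbr p" "x \<in> low p" | "x \<noteq> p" "x \<in> nbr p" "x \<notin> low p"
  using assms self_notin_nbr[of p] low_subset_nbr[of p] unfolding T_def by blast

lemma nbr_antisym:
  assumes "u \<in> nbr p" "w \<in> nbr p" "(u \<in> low p) = (w \<in> low p)" "u \<le> p \<squnion> w" "w \<le> p \<squnion> u"
  shows "u = w"
  using common_partner[OF assms(1,2,2,3,3)] side_antisym assms(4,5) by metis

lemma nbr_total:
  assumes "u \<in> nbr p" "w \<in> nbr p" "(u \<in> low p) = (w \<in> low p)"
  shows "u \<le> p \<squnion> w \<or> w \<le> p \<squnion> u"
  using common_partner[OF assms(1,2,2,3,3)] side_total by metis

lemma nbr_between: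
  assumes "u \<in> nbr p" "v \<in> nbr p" "w \<in> nbr p"
    and "(u \<in> low p) = (v \<in> low p)" "(u \<in> low p) = (w \<in> low p)" "u \<le> p \<squnion> v" "v \<le> p \<squnion> w"
  shows "v \<le> u \<squnion> w"
  using common_partner[OF assms(1-5)] side_between assms(6,7) by metis

lemma linear_order_ord: "linear_order_on (T p) (ord p)"
proof -
  have "ord p \<subseteq> T p \<times> T p" unfolding ord_def by blast
  moreover have "refl_on (T p) (ord p)" unfolding ord_def by (auto intro!: refl_onI)
  moreover have "trans (ord p)"
  proof (rule transI)
    fix x y z assume "(x, y) \<in> ord p" "(y, z) \<in> ord p"
    then show "(x, z) \<in> ord p"
      using side_trans[of x p y z] side_trans[of z p y x] unfolding ord_def by blast
  qed
  moreover have "antisym (ord p)"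
  proof (rule antisymI)
    fix x y assume xy: "(x, y) \<in> ord p" "(y, x) \<in> ord p"
    then have "x \<in> T p" "y \<in> T p" unfolding ord_def by blast+
    then show "x = y"
      using xy nbr_antisym[of x p y] unfolding ord_def by (elim T_cases) (auto simp: T_def)
  qed
  moreover have "total_on (T p) (ord p)"
  proof (rule total_onI)
    fix x y assume xy: "x \<in> T p" "y \<in> T p"
    then show "(x, y) \<in> ord p \<or> (y, x) \<in> ord p"
      using nbr_total[of x p y] unfolding ord_def by (elim T_cases) (auto simp: T_def)
  qed
  ultimately show ?thesis by (simp add: order_on_defs)
qed

text \<open>This is what makes the sets \<open>rep p x\<close> convex. If the interval contains
  \<open>p\<close>, then \<open>p \<le> x \<squnion> y\<close>, and every other point of the
  interval is below the join of \<open>p\<close> with the endpoint on its own side. Otherwise all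
  three points are on one side and \<open>nbr_between\<close> applies.\<close>

lemma ord_convex:
  assumes "(x, z) \<in> ord p" "(z, y) \<in> ord p"
  shows "z \<le> x \<squnion> y"
proof -
  have T: "x \<in> T p" "y \<in> T p" "z \<in> T p" using assms unfolding ord_def by blast+
  have *: "z \<le> x \<squnion> y" if "p \<le> x \<squnion> y" "z \<le> p \<squnion> y \<or> z \<le> p \<squnion> x"
    using that by (meson le_sup_iff order_trans sup_ge1 sup_ge2)
  show ?thesis
    using T(3)
  proof (cases rule: T_cases)
    case 1
    then show ?thesis
      using assms T(1,2) edge_iff_low[of x p y] unfolding ord_def by (elim T_cases) (auto simp: le_supI1 le_supI2)
  next
    case 2
    then have x: "x \<in> low p" "z \<le> p \<squnion> x" "x \<in> nbr p" using assms(1) low_subset_nbr unfolding ord_def by blast+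
    show ?thesis
      using T(2)
    proof (cases rule: T_cases)
      case y: 2
      then have "y \<le> p \<squnion> z" using assms(2) 2 unfolding ord_def by blast
      then show ?thesis using nbr_between[of y p z x] x 2 y by (simp add: sup_commute)
    qed (use x edge_iff_low[of x p y] * in auto)
  next
    case 3
    then have y: "y \<notin> low p" "z \<le> p \<squnion> y" "y \<in> nbr p" using assms(2) T(2) unfolding ord_def T_def by blast+
    show ?thesis
      using T(1)
    proof (cases rule: T_cases)
      case x: 3
      then have "x \<le> p \<squnion> z" using assms(1) 3 unfolding ord_def by blast
      then show ?thesis using nbr_between[of x p z y] x 3 y by simp
    qed (use y edge_iff_low[of x p y] * in auto)
  qed
qed

section \<open>Bracketing a point of the chain: joins are preserved\<close>

text \<open>Provides a bound for \<open>b\<close> on the side away from \<open>p\<close>. Refining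
  \<open>p \<le> s \<squnion> a\<close> gives a candidate \<open>u\<close>. If \<open>u\<close> were
  closer to \<open>p\<close> than \<open>b\<close>, (P) would give
  \<open>b \<le> w \<squnion> u\<close> for \<open>w\<close> equal to \<open>s\<close> or
  \<open>t\<close>. The first puts \<open>b\<close> below \<open>s\<close>; the second gives
  \<open>u = s\<close> by minimality of the cover of \<open>b\<close>, and then
  \<open>b \<le> p \<squnion> u\<close> after all.\<close>

lemma split_far:
  assumes ba: "cov p b a" and st: "cov b s t" and bs: "b \<le> p \<squnion> s" and sa: "p \<le> s \<squnion> a"
  obtains u where "u \<le> s" "cov p u a" "b \<le> p \<squnion> u"
proof -
  have p: "p \<in> J" using covD[OF ba] by blast
  have "\<not> p \<le> s" using bs covD(5)[OF st] by (auto simp: sup_absorb2)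
  then obtain u a' where u: "u \<le> s" "a' \<le> a" "cov p u a'"
    using refine[OF p sa] covD(6)[OF ba] by blast
  have "p \<le> u \<squnion> a" using covD(4)[OF u(3)] u(2) by (meson order_trans sup_mono order_refl)
  then have ua: "cov p u a" using cov_iff_nbr covD(7)[OF u(3)] covD(8)[OF ba] by blast
  have "b \<le> p \<squnion> u"
  proof (rule ccontr)
    assume not: "\<not> b \<le> p \<squnion> u"
    have "p \<le> a \<squnion> u" using covD(4)[OF ua] by (simp add: sup_commute)
    from J_P[OF p covD(4)[OF ba] this covD(4)[OF st]]
    consider "p \<le> b \<sqinter> (p \<squnion> u) \<squnion> a" | w where "w \<in> {s, t}" "p \<le> b \<sqinter> (p \<squnion> w) \<sqinter> (w \<squnion> u) \<squnion> a"
      using covD(5)[OF ba] covD(5)[OF ua] by blast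
    then show False
    proof cases
      case 1
      then show False using cov_le_left[OF ba] not by blast
    next
      case 2
      then have "b \<le> (p \<squnion> w) \<sqinter> (w \<squnion> u)" by (intro cov_le_left[OF ba]) (simp add: inf_assoc)
      then have "b \<le> w \<squnion> u" by simp
      show False
      proof (cases "w = s")
        case True
        then show False using \<open>b \<le> w \<squnion> u\<close> u(1) covD(5)[OF st] by (simp add: sup_absorb1)
      next
        case False
        then have "b \<le> u \<squnion> t" using 2(1) \<open>b \<le> w \<squnion> u\<close> by (simp add: sup_commute)
        then show False using cov_minimal1[OF st u(1)] not bs by blast
      qed
    qed
  qed
  with u(1) ua that show thesis by blast
qed

text \<open>Provides the bound towards \<open>p\<close>, which may be \<open>p\<close> itself or lie
  beyond it. If the neighbour \<open>v\<close> obtained below \<open>t\<close> is on the side of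
  \<open>b\<close>, it cannot be at least as far out as \<open>b\<close>: this would give
  \<open>b \<le> a \<squnion> t\<close> in addition to \<open>b \<le> a \<squnion> s\<close> and
  \<open>b \<le> s \<squnion> t\<close>, and (U) at \<open>b\<close> would put \<open>b\<close>
  below \<open>a\<close>, \<open>s\<close> or \<open>t\<close>.\<close>

lemma split_near:
  assumes ba: "cov p b a" and st: "cov b s t" and bs: "b \<le> p \<squnion> s" and sa: "p \<le> s \<squnion> a"
    and t: "p \<le> b \<squnion> t \<or> p \<le> t \<squnion> a"
  obtains v where "v \<le> t" "v = p \<or> cov p b v \<or> cov p v a \<and> v \<le> p \<squnion> b"
proof -
  have p: "p \<in> J" using covD[OF ba] by blast
  consider "p \<le> t" | "\<not> p \<le> t" "p \<le> b \<squnion> t" | "\<not> p \<le> t" "p \<le> t \<squnion> a" using t by blast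
  then show thesis
  proof cases
    case 1
    then have "p = t" using cov_minimal2[OF st] bs by (simp add: sup_commute)
    then show thesis using that[of p] by blast
  next
    case 2
    then obtain b' v where v: "b' \<le> b" "v \<le> t" "cov p b' v"
      using refine[OF p 2(2)] covD(5)[OF ba] by blast
    have "p \<le> b \<squnion> v" using covD(4)[OF v(3)] v(1) by (meson order_trans sup_mono order_refl)
    then have "cov p b v" using cov_iff_nbr covD(8)[OF v(3)] covD(7)[OF ba] by blast
    then show thesis using that v(2) by blast
  next
    case 3
    then obtain v a' where v: "v \<le> t" "a' \<le> a" "cov p v a'"
      using refine[OF p 3(2)] covD(6)[OF ba] by blast
    have pva: "p \<le> v \<squnion> a" using covD(4)[OF v(3)] v(2) by (meson order_trans sup_mono order_refl)
    then have va: "cov p v a" using cov_iff_nbr covD(7)[OF v(3)] covD(8)[OF ba] by blast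
    have "\<not> b \<le> p \<squnion> v"
    proof
      assume "b \<le> p \<squnion> v"
      have "p \<squnion> v \<le> a \<squnion> t" "p \<squnion> s \<le> a \<squnion> s"
        using 3(2) sa v(1) by (simp_all add: sup_commute le_supI2)
      then have "b \<le> a \<squnion> t" "b \<le> a \<squnion> s" using \<open>b \<le> p \<squnion> v\<close> bs order_trans by blast+
      moreover have "\<not> b \<le> a" using covD(4,6)[OF ba] by (auto simp: sup_absorb2)
      ultimately show False using J_U[OF covD(1)[OF st], of a s t] covD[OF st] by blast
    qed
    then show thesis using that v(1) va side_total[OF va ba] by blast
  qed
qed

text \<open>(HS) at \<open>p\<close> decides which of \<open>s\<close> and \<open>t\<close> plays
  the far role. Its joinands with a meet of \<open>b\<close> and \<open>s\<close> or
  \<open>t\<close> are excluded because they would put \<open>b\<close> below one half of its own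
  cover; the remaining ones supply exactly the hypotheses of \<open>split_far\<close> and
  \<open>split_near\<close>.\<close>

lemma split_nbr:
  assumes ba: "cov p b a" and st: "cov b s t"
  shows "\<exists>u v. (u \<le> s \<and> v \<le> t \<or> u \<le> t \<and> v \<le> s) \<and> cov p u a \<and> b \<le> p \<squnion> u \<and>
    (v = p \<or> cov p b v \<or> cov p v a \<and> v \<le> p \<squnion> b)"
proof -
  have "\<not> p \<le> b \<sqinter> w \<squnion> a" if "w \<in> {s, t}" for w
    using cov_le_left[OF ba] covD(5,6)[OF st] that by blast
  then obtain s' t' where *: "(s', t') \<in> {(s, t), (t, s)}"
    "p \<le> b \<sqinter> (p \<squnion> s') \<squnion> a" "p \<le> s' \<squnion> a" "p \<le> b \<squnion> t' \<or> p \<le> t' \<squnion> a"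
    using J_HS[OF covD(1)[OF ba] covD(4)[OF ba] covD(4)[OF st]] covD(5)[OF ba] by blast
  have st': "cov b s' t'" using *(1) st cov_sym by blast
  have bs: "b \<le> p \<squnion> s'" using cov_le_left[OF ba *(2)] .
  obtain u where "u \<le> s'" "cov p u a" "b \<le> p \<squnion> u" using split_far[OF ba st' bs *(3)] .
  moreover obtain v where "v \<le> t'" "v = p \<or> cov p b v \<or> cov p v a \<and> v \<le> p \<squnion> b"
    using split_near[OF ba st' bs *(3,4)] .
  ultimately show ?thesis using *(1) by blast
qed

lemma split_T:
  assumes p: "p \<in> J" and b: "b \<in> T p" and "b \<le> x \<squnion> y" "\<not> b \<le> x" "\<not> b \<le> y"
  shows "\<exists>u v. (u \<le> x \<and> v \<le> y \<or> u \<le> y \<and> v \<le> x) \<and> (u, b) \<in> ord p \<and> (b, v) \<in> ord p"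
proof -
  have "b \<in> J" using b p nbrD(2) unfolding T_def by blast
  then obtain s t where st: "s \<le> x" "t \<le> y" "cov b s t" using refine assms(3-5) by blast
  have "\<exists>u v. (u \<le> s \<and> v \<le> t \<or> u \<le> t \<and> v \<le> s) \<and> (u, b) \<in> ord p \<and> (b, v) \<in> ord p"
  \<comment> \<open>For \<open>b = p\<close> the cover \<open>s\<close>, \<open>t\<close> is itself
    an edge of the graph, with one end on each side of \<open>p\<close>.\<close>
  proof (cases "b = p")
    case True
    then show ?thesis
      using cov_low[of p s t] covD[of p s t] st(3) self_notin_nbr[of p] low_subset_nbr[of p]
      unfolding ord_def T_def by blast
  next
    case False
    then obtain a where ba: "cov p b a" using b unfolding T_def nbr_def by blast
    obtain u v where uv: "u \<le> s \<and> v \<le> t \<or> u \<le> t \<and> v \<le> s" "cov p u a" "b \<le> p \<squnion> u"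
      "v = p \<or> cov p b v \<or> cov p v a \<and> v \<le> p \<squnion> b"
      using split_nbr[OF ba st(3)] by blast
    have nbr: "u \<in> T p" "v \<in> T p" "p \<notin> low p" "u \<noteq> p" "v \<noteq> p \<longrightarrow> v \<in> nbr p"
      using covD[OF uv(2)] uv(4) covD[of p] self_notin_nbr[of p] low_subset_nbr[of p] unfolding T_def by blast+
    have low: "u \<in> low p \<longleftrightarrow> b \<in> low p"
      "v \<noteq> p \<Longrightarrow> \<not> cov p b v \<Longrightarrow> v \<in> low p \<longleftrightarrow> b \<in> low p" "cov p b v \<Longrightarrow> v \<in> low p \<longleftrightarrow> b \<notin> low p"
      using cov_low[OF ba] cov_low[OF uv(2)] cov_low[of p v a] cov_low[of p b v] uv(4) by blast+
    \<comment> \<open>The far bound \<open>u\<close> precedes \<open>b\<close> on the low side and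
      follows it on the other side.\<close>
    have "if b \<in> low p then (u, b) \<in> ord p \<and> (b, v) \<in> ord p else (v, b) \<in> ord p \<and> (b, u) \<in> ord p"
      using nbr low uv(3,4) b False unfolding ord_def by auto
    then show ?thesis using uv(1) by (cases "b \<in> low p") auto
  qed
  then show ?thesis using st(1,2) order_trans by meson
qed

definition rep :: "'k \<Rightarrow> 'k \<Rightarrow> 'k set" where "rep p x = {q \<in> T p. q \<le> x}"

lemma rep_Co: "rep p x \<in> Co (T p) (ord p)"
  unfolding Co_def order_convex_def rep_def
  using order_trans[OF ord_convex le_supI] by blast

lemma rep_inf: "rep p (x \<sqinter> y) = rep p x \<inter> rep p y"
  unfolding rep_def by auto

lemma rep_sup:
  assumes "p \<in> J"
  shows "rep p (x \<squnion> y) = Co_join (ord p) (rep p x) (rep p y)"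
proof
  show "Co_join (ord p) (rep p x) (rep p y) \<subseteq> rep p (x \<squnion> y)"
    by (rule Co_join_least[OF linear_order_ord rep_Co]) (auto simp: rep_def le_supI1 le_supI2)
  show "rep p (x \<squnion> y) \<subseteq> Co_join (ord p) (rep p x) (rep p y)"
  proof
    fix b assume "b \<in> rep p (x \<squnion> y)"
    then have b: "b \<in> T p" "b \<le> x \<squnion> y" unfolding rep_def by blast+
    show "b \<in> Co_join (ord p) (rep p x) (rep p y)"
    proof (cases "b \<le> x \<or> b \<le> y")
      case True
      then show ?thesis using b(1) unfolding Co_join_def rep_def by blast
    next
      case False
      then obtain u v where uv: "u \<le> x \<and> v \<le> y \<or> u \<le> y \<and> v \<le> x" "(u, b) \<in> ord p" "(b, v) \<in> ord p"
        using split_T[OF assms b] by blast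
      then have "u \<in> T p" "v \<in> T p" unfolding ord_def by blast+
      with uv show ?thesis unfolding Co_join_def rep_def by blast
    qed
  qed
qed

lemma T_subset_J: "p \<in> J \<Longrightarrow> T p \<subseteq> J"
  unfolding T_def using nbrD(2) by blast

end

section \<open>The lattice of filters\<close>

text \<open>
  Filters are ordered by reverse inclusion, so that the lattice embeds by principal filters.
\<close>

definition is_filter :: "'a::lattice set \<Rightarrow> bool" where
  "is_filter F \<longleftrightarrow> F \<noteq> {} \<and> (\<forall>x\<in>F. \<forall>y. x \<le> y \<longrightarrow> y \<in> F) \<and> (\<forall>x\<in>F. \<forall>y\<in>F. x \<sqinter> y \<in> F)"

typedef (overloaded) 'a filt = "{F :: 'a::lattice set. is_filter F}"
  morphisms filter_set Abs_filt
  by (rule exI[of _ UNIV]) (simp add: is_filter_def)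

lemma filter_set_nonempty: "filter_set F \<noteq> {}"
  and filter_set_up: "x \<in> filter_set F \<Longrightarrow> x \<le> y \<Longrightarrow> y \<in> filter_set F"
  and filter_set_inf: "x \<in> filter_set F \<Longrightarrow> y \<in> filter_set F \<Longrightarrow> x \<sqinter> y \<in> filter_set F"
  using filter_set[of F] unfolding is_filter_def by blast+

instantiation filt :: (lattice) lattice
begin

definition less_eq_filt :: "'a filt \<Rightarrow> 'a filt \<Rightarrow> bool" where
  "F \<le> G \<longleftrightarrow> filter_set G \<subseteq> filter_set F"

definition less_filt :: "'a filt \<Rightarrow> 'a filt \<Rightarrow> bool" where
  "F < G \<longleftrightarrow> filter_set G \<subset> filter_set F"

definition sup_filt :: "'a filt \<Rightarrow> 'a filt \<Rightarrow> 'a filt" where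
  "F \<squnion> G = Abs_filt (filter_set F \<inter> filter_set G)"

definition inf_filt :: "'a filt \<Rightarrow> 'a filt \<Rightarrow> 'a filt" where
  "F \<sqinter> G = Abs_filt {z. \<exists>x\<in>filter_set F. \<exists>y\<in>filter_set G. x \<sqinter> y \<le> z}"

lemma filter_set_sup': "filter_set (F \<squnion> G) = filter_set F \<inter> filter_set G"
proof -
  obtain x y where "x \<in> filter_set F" "y \<in> filter_set G" using filter_set_nonempty by blast
  then have "x \<squnion> y \<in> filter_set F \<inter> filter_set G" using filter_set_up sup_ge1 sup_ge2 by blast
  then have "is_filter (filter_set F \<inter> filter_set G)"
    unfolding is_filter_def using filter_set_up filter_set_inf by blast
  then show ?thesis unfolding sup_filt_def by (simp add: Abs_filt_inverse)
qed

lemma filter_set_inf': "filter_set (F \<sqinter> G) = {z. \<exists>x\<in>filter_set F. \<exists>y\<in>filter_set G. x \<sqinter> y \<le> z}"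
proof -
  let ?S = "{z. \<exists>x\<in>filter_set F. \<exists>y\<in>filter_set G. x \<sqinter> y \<le> z}"
  have "z \<sqinter> z' \<in> ?S" if zz: "z \<in> ?S" "z' \<in> ?S" for z z'
  proof -
    obtain x y x' y' where *: "x \<in> filter_set F" "y \<in> filter_set G" "x \<sqinter> y \<le> z"
      "x' \<in> filter_set F" "y' \<in> filter_set G" "x' \<sqinter> y' \<le> z'"
      using zz by blast
    have "(x \<sqinter> x') \<sqinter> (y \<sqinter> y') = (x \<sqinter> y) \<sqinter> (x' \<sqinter> y')" by (simp add: inf_aci)
    also have "\<dots> \<le> z \<sqinter> z'" using * by (intro inf_mono)
    finally show ?thesis using * filter_set_inf by blast
  qed
  moreover have "?S \<noteq> {}" using filter_set_nonempty[of F] filter_set_nonempty[of G] by blast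
  ultimately have "is_filter ?S" unfolding is_filter_def by (blast intro: order_trans)
  then show ?thesis unfolding inf_filt_def by (simp add: Abs_filt_inverse)
qed

instance
proof
  fix F G H :: "'a filt"
  obtain x y where xy: "x \<in> filter_set F" "y \<in> filter_set G" using filter_set_nonempty by blast
  have "z \<sqinter> y \<le> z" "x \<sqinter> z \<le> z" for z by simp_all
  with xy show "F \<sqinter> G \<le> F" "F \<sqinter> G \<le> G"
    unfolding less_eq_filt_def filter_set_inf' by blast+
  show "F \<le> G \<Longrightarrow> F \<le> H \<Longrightarrow> F \<le> G \<sqinter> H"
    unfolding less_eq_filt_def filter_set_inf' by (blast intro: filter_set_up filter_set_inf)
qed (auto simp: less_eq_filt_def less_filt_def filter_set_sup' filter_set_inject[symmetric])

end

section \<open>Transfer of the identities to filters\<close>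

text \<open>Brings the join into the form of \<open>filter_set_inf'\<close>, which is the form that
  \<open>extends_binary\<close> requires of an operation.\<close>

lemma mem_filter_set_sup: "z \<in> filter_set (F \<squnion> G) \<longleftrightarrow> (\<exists>x\<in>filter_set F. \<exists>y\<in>filter_set G. x \<squnion> y \<le> z)"
  unfolding filter_set_sup' using filter_set_up by (meson IntD1 IntD2 IntI le_sup_iff order_refl sup_least)

text \<open>
  All lattice terms extend to filters in this way, so identities carry over.
\<close>

definition extends :: "((nat \<Rightarrow> 'a::lattice) \<Rightarrow> 'a) \<Rightarrow> ((nat \<Rightarrow> 'a filt) \<Rightarrow> 'a filt) \<Rightarrow> bool" where
  "extends f F \<longleftrightarrow> (\<forall>v w. (\<forall>n. v n \<le> w n) \<longrightarrow> f v \<le> f w) \<and>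
    (\<forall>V. filter_set (F V) = {z. \<exists>v. (\<forall>n. v n \<in> filter_set (V n)) \<and> f v \<le> z})"

lemma extends_eq:
  assumes "extends f F" "extends g G" "\<And>v. f v = g v"
  shows "F = G"
proof (rule ext)
  fix V
  have "f = g" using assms(3) by (rule ext)
  then have "filter_set (F V) = filter_set (G V)" using assms(1,2) unfolding extends_def by simp
  then show "F V = G V" by (simp only: filter_set_inject)
qed

lemma extends_var: "extends (\<lambda>v. v n) (\<lambda>V. V n)"
proof -
  have "z \<in> filter_set (V n) \<longleftrightarrow> (\<exists>v. (\<forall>n. v n \<in> filter_set (V n)) \<and> v n \<le> z)"
    for z and V :: "nat \<Rightarrow> 'a filt"
  proof
    assume z: "z \<in> filter_set (V n)"
    \<comment> \<open>A valuation must choose a member of every filter \<open>V m\<close>, also of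
      those that do not occur in the term.\<close>
    have "\<exists>v. \<forall>m. v m \<in> filter_set (V m)" by (rule choice) (use filter_set_nonempty in blast)
    then obtain v where "\<forall>m. v m \<in> filter_set (V m)" by blast
    then have "\<forall>m. (v(n := z)) m \<in> filter_set (V m)" "(v(n := z)) n \<le> z" using z by simp_all
    then show "\<exists>v. (\<forall>n. v n \<in> filter_set (V n)) \<and> v n \<le> z" by blast
  qed (use filter_set_up in blast)
  then show ?thesis unfolding extends_def by blast
qed

text \<open>Two subterms may come with different valuations \<open>v\<close> and \<open>w\<close>.
  Their pointwise meet again takes values in the filters, and monotonicity makes it serve both; this
  is why identities with repeated variables carry over.\<close>

lemma extends_binary:
  assumes f: "extends f F" and g: "extends g G"
    and mono: "\<And>x y x' y'. x \<le> x' \<Longrightarrow> y \<le> y' \<Longrightarrow> h x y \<le> h x' y'"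
    and H: "\<And>X Y. filter_set (H X Y) = {z. \<exists>x\<in>filter_set X. \<exists>y\<in>filter_set Y. h x y \<le> z}"
  shows "extends (\<lambda>v. h (f v) (g v)) (\<lambda>V. H (F V) (G V))"
proof -
  have "z \<in> filter_set (H (F V) (G V)) \<longleftrightarrow> (\<exists>v. (\<forall>n. v n \<in> filter_set (V n)) \<and> h (f v) (g v) \<le> z)"
    for z V
  proof
    assume "z \<in> filter_set (H (F V) (G V))"
    then obtain x y where "x \<in> filter_set (F V)" "y \<in> filter_set (G V)" "h x y \<le> z" unfolding H by blast
    then obtain v w where *: "\<forall>n. v n \<in> filter_set (V n)" "f v \<le> x" "\<forall>n. w n \<in> filter_set (V n)" "g w \<le> y"
      using f g unfolding extends_def by blast
    have "f (\<lambda>n. v n \<sqinter> w n) \<le> f v" "g (\<lambda>n. v n \<sqinter> w n) \<le> g w"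
      using f g unfolding extends_def by simp_all
    then have "h (f (\<lambda>n. v n \<sqinter> w n)) (g (\<lambda>n. v n \<sqinter> w n)) \<le> h x y"
      using *(2,4) by (intro mono) (rule order_trans, assumption+)+
    then show "\<exists>v. (\<forall>n. v n \<in> filter_set (V n)) \<and> h (f v) (g v) \<le> z"
      using *(1,3) \<open>h x y \<le> z\<close>
      by (intro exI[of _ "\<lambda>n. v n \<sqinter> w n"]) (auto intro: order_trans filter_set_inf)
  next
    assume "\<exists>v. (\<forall>n. v n \<in> filter_set (V n)) \<and> h (f v) (g v) \<le> z"
    then obtain v where v: "\<forall>n. v n \<in> filter_set (V n)" "h (f v) (g v) \<le> z" by blast
    then have "f v \<in> filter_set (F V)" "g v \<in> filter_set (G V)" using f g unfolding extends_def by auto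
    with v(2) show "z \<in> filter_set (H (F V) (G V))" unfolding H by blast
  qed
  then show ?thesis using f g mono unfolding extends_def by blast
qed

lemma extends_sup: "extends f F \<Longrightarrow> extends g G \<Longrightarrow> extends (\<lambda>v. f v \<squnion> g v) (\<lambda>V. F V \<squnion> G V)"
  by (rule extends_binary[where h = "(\<squnion>)" and H = "(\<squnion>)"]) (auto simp: mem_filter_set_sup intro: sup_mono le_supI1 le_supI2)

lemma extends_inf: "extends f F \<Longrightarrow> extends g G \<Longrightarrow> extends (\<lambda>v. f v \<sqinter> g v) (\<lambda>V. F V \<sqinter> G V)"
  by (rule extends_binary[where h = "(\<sqinter>)" and H = "(\<sqinter>)"]) (auto simp: filter_set_inf' intro: le_infI1 le_infI2)

lemma extends_Sup_fin:
  assumes "finite S" "S \<noteq> {}" "\<And>i. extends (f i) (F i)"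
  shows "extends (\<lambda>v. Sup_fin ((\<lambda>i. f i v) ` S)) (\<lambda>V. Sup_fin ((\<lambda>i. F i V) ` S))"
  using assms(1,2)
proof (induction S rule: finite_ne_induct)
  case (insert i S)
  then show ?case using extends_sup[OF assms(3)[of i]] by simp
qed (simp add: assms(3))

lemma extends_Inf_fin:
  assumes "finite S" "S \<noteq> {}" "\<And>i. extends (f i) (F i)"
  shows "extends (\<lambda>v. Inf_fin ((\<lambda>i. f i v) ` S)) (\<lambda>V. Inf_fin ((\<lambda>i. F i V) ` S))"
  using assms(1,2)
proof (induction S rule: finite_ne_induct)
  case (insert i S)
  then show ?case using extends_inf[OF assms(3)[of i]] by simp
qed (simp add: assms(3))

lemmas extends_intros = extends_sup extends_inf extends_Sup_fin extends_Inf_fin extends_var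

lemma lessThan_ne: "{..<2::nat} \<noteq> {}" "{..<3::nat} \<noteq> {}"
  unfolding lessThan_2 lessThan_3 by blast+

text \<open>All variables are merged into one valuation on the natural numbers, so that an identity
  becomes an equation between two functions of that valuation, as \<open>extends_eq\<close> asks.
  The other four identities are treated alike, with indexed variables placed after the single
  ones.\<close>

lemma filt_identity_U:
  assumes "identity_U TYPE('a::lattice)"
  shows "identity_U TYPE('a filt)"
proof -
  have eq: "(\<lambda>v. v 0 \<sqinter> (v 1 \<squnion> v 2) \<sqinter> (v 1 \<squnion> v 3) \<sqinter> (v 2 \<squnion> v 3)) =
    (\<lambda>v :: nat \<Rightarrow> 'a filt. v 0 \<sqinter> v 1 \<sqinter> (v 2 \<squnion> v 3) \<squnion> v 0 \<sqinter> v 2 \<sqinter> (v 1 \<squnion> v 3) \<squnion> v 0 \<sqinter> v 3 \<sqinter> (v 1 \<squnion> v 2))"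
    by (rule extends_eq, (rule extends_intros finite_lessThan finite_Diff finite_permutes_3
        permutes_3_nonempty )+)
      (rule assms[unfolded identity_U_def, rule_format])
  show ?thesis
    unfolding identity_U_def
  proof (intro allI, goal_cases)
    case (1 x x0 x1 x2)
    define V where "V n = (if n = 0 then x else if n = 1 then x0 else if n = 2 then x1 else x2)" for n :: nat
    have V: "x = V 0" "x0 = V 1" "x1 = V 2" "x2 = V 3" by (simp_all add: V_def)
    show ?case unfolding V by (rule fun_cong[OF eq])
  qed
qed

lemma filt_identity_B:
  assumes "identity_B TYPE('a::lattice)"
  shows "identity_B TYPE('a filt)"
proof -
  \<comment> \<open>The \<open>a i\<close> sit at odd and the \<open>b i\<close> at positive even
    positions. Positions such as \<open>2 * 0 + 1\<close> stay unevaluated to match literally what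
    \<open>unfolding V\<close> makes of \<open>a 0\<close>.\<close>
  have eq: "(\<lambda>v. v 0 \<sqinter> (v (2 * 0 + 1) \<squnion> v (2 * 1 + 1)) \<sqinter> (v (2 * 0 + 2) \<squnion> v (2 * 1 + 2))) =
    (\<lambda>v :: nat \<Rightarrow> 'a filt. Sup_fin ((\<lambda>i. v 0 \<sqinter> v (2 * i + 1) \<sqinter> (v (2 * 0 + 2) \<squnion> v (2 * 1 + 2)) \<squnion>
        v 0 \<sqinter> v (2 * i + 2) \<sqinter> (v (2 * 0 + 1) \<squnion> v (2 * 1 + 1))) ` {..<2}) \<squnion>
      Sup_fin ((\<lambda>i. v 0 \<sqinter> (v (2 * 0 + 1) \<squnion> v (2 * 1 + 1)) \<sqinter> (v (2 * 0 + 2) \<squnion> v (2 * 1 + 2)) \<sqinter>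
        (v (2 * 0 + 1) \<squnion> v (2 * i + 2)) \<sqinter> (v (2 * 1 + 1) \<squnion> v (2 * (1 - i) + 2))) ` {..<2}))"
    by (rule extends_eq, (rule extends_intros finite_lessThan finite_Diff finite_permutes_3
        permutes_3_nonempty lessThan_ne)+)
      (rule assms[unfolded identity_B_def, rule_format, where a = "\<lambda>i. v (2 * i + 1)" and b = "\<lambda>i. v (2 * i + 2)" for v])
  show ?thesis
    unfolding identity_B_def
  proof (intro allI, goal_cases)
    case (1 x a b)
    define V where "V n = (if n = 0 then x else if odd n then a (n div 2) else b (n div 2 - 1))" for n :: nat
    have V: "x = V 0" "a i = V (2 * i + 1)" "b i = V (2 * i + 2)" for i by (simp_all add: V_def)
    show ?case unfolding V by (rule fun_cong[OF eq])
  qed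
qed

lemma filt_identity_E:
  assumes "identity_E TYPE('a::lattice)"
  shows "identity_E TYPE('a filt)"
proof -
  have "{..<3} - {i} \<noteq> {}" for i :: nat
    by (cases "i = 0") (auto simp: lessThan_3)
  note lessThan_3_ne = this
  have eq: "(\<lambda>v. v 0 \<sqinter> Inf_fin ((\<lambda>i. v 1 \<squnion> v (i + 2)) ` {..<3})) =
    (\<lambda>v :: nat \<Rightarrow> 'a filt. Sup_fin ((\<lambda>i. v 0 \<sqinter> v (i + 2) \<sqinter> Inf_fin ((\<lambda>j. v 1 \<squnion> v (j + 2)) ` ({..<3} - {i}))) ` {..<3}) \<squnion>
      Sup_fin ((\<lambda>\<sigma>. v 0 \<sqinter> (v 1 \<squnion> v (\<sigma> 0 + 2) \<sqinter> (v 0 \<squnion> v (\<sigma> 1 + 2))) \<sqinter>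
        (v 1 \<squnion> v (\<sigma> 1 + 2) \<sqinter> (v 0 \<squnion> v (\<sigma> 2 + 2)) \<sqinter> (v (\<sigma> 0 + 2) \<squnion> v (\<sigma> 2 + 2))) \<sqinter>
        (v 1 \<squnion> v (\<sigma> 2 + 2))) ` {\<sigma>. \<sigma> permutes {..<3}}))"
    by (rule extends_eq, (rule extends_intros finite_lessThan finite_Diff finite_permutes_3
        permutes_3_nonempty lessThan_ne lessThan_3_ne)+)
      (rule assms[unfolded identity_E_def Let_def, rule_format, where b = "\<lambda>i. v (i + 2)" for v])
  show ?thesis
    unfolding identity_E_def Let_def
  proof (intro allI, goal_cases)
    case (1 x a b)
    define V where "V n = (if n = 0 then x else if n = 1 then a else b (n - 2))" for n :: nat
    have V: "x = V 0" "a = V 1" "b i = V (i + 2)" for i by (simp_all add: V_def)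
    show ?case unfolding V by (rule fun_cong[OF eq])
  qed
qed

lemma filt_identity_P:
  assumes "identity_P TYPE('a::lattice)"
  shows "identity_P TYPE('a filt)"
proof -
  have eq: "(\<lambda>v. v 0 \<sqinter> (v 1 \<sqinter> (v (0 + 4) \<squnion> v (1 + 4)) \<squnion> v 2) \<sqinter> (v 2 \<squnion> v 3)) =
    (\<lambda>v :: nat \<Rightarrow> 'a filt. v 0 \<sqinter> (v 1 \<sqinter> (v (0 + 4) \<squnion> v (1 + 4))) \<sqinter> (v 2 \<squnion> v 3) \<squnion> v 0 \<sqinter> v 3 \<sqinter> (v 1 \<sqinter> (v (0 + 4) \<squnion> v (1 + 4)) \<squnion> v 2) \<squnion>
      v 0 \<sqinter> (v 1 \<sqinter> (v (0 + 4) \<squnion> v (1 + 4)) \<sqinter> (v 0 \<squnion> v 3) \<squnion> v 2) \<sqinter> (v 2 \<squnion> v 3) \<squnion>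
      Sup_fin ((\<lambda>i. v 0 \<sqinter> (v (i + 4) \<squnion> v 2) \<sqinter>
        (v 1 \<sqinter> (v (0 + 4) \<squnion> v (1 + 4)) \<sqinter> (v 0 \<squnion> v (i + 4)) \<sqinter> (v (i + 4) \<squnion> v 3) \<squnion> v 2) \<sqinter> (v 2 \<squnion> v 3)) ` {..<2}))"
    by (rule extends_eq, (rule extends_intros finite_lessThan finite_Diff finite_permutes_3
        permutes_3_nonempty lessThan_ne)+)
      (rule assms[unfolded identity_P_def Let_def, rule_format, where bs = "\<lambda>i. v (i + 4)" for v])
  show ?thesis
    unfolding identity_P_def Let_def
  proof (intro allI, goal_cases)
    case (1 a b c d bs)
    define V where "V n = (if n = 0 then a else if n = 1 then b else if n = 2 then c else if n = 3 then d
      else bs (n - 4))" for n :: nat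
    have V: "a = V 0" "b = V 1" "c = V 2" "d = V 3" "bs i = V (i + 4)" for i by (simp_all add: V_def)
    show ?case unfolding V by (rule fun_cong[OF eq])
  qed
qed

lemma filt_identity_HS:
  assumes "identity_HS TYPE('a::lattice)"
  shows "identity_HS TYPE('a filt)"
proof -
  have eq: "(\<lambda>v. v 0 \<sqinter> (v 1 \<sqinter> (v (0 + 3) \<squnion> v (1 + 3)) \<squnion> v 2)) =
    (\<lambda>v :: nat \<Rightarrow> 'a filt. v 0 \<sqinter> (v 1 \<sqinter> (v (0 + 3) \<squnion> v (1 + 3))) \<squnion> Sup_fin ((\<lambda>i. v 0 \<sqinter> (v 1 \<sqinter> v (i + 3) \<squnion> v 2)) ` {..<2}) \<squnion>
      Sup_fin ((\<lambda>i. v 0 \<sqinter> (v 1 \<sqinter> (v (0 + 3) \<squnion> v (1 + 3)) \<sqinter> (v 0 \<squnion> v (i + 3)) \<squnion> v 2) \<sqinter>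
        (v (i + 3) \<squnion> v 2) \<sqinter> (v 1 \<squnion> v (1 - i + 3))) ` {..<2}) \<squnion>
      Sup_fin ((\<lambda>i. v 0 \<sqinter> (v 1 \<sqinter> (v (0 + 3) \<squnion> v (1 + 3)) \<sqinter> (v 0 \<squnion> v (i + 3)) \<squnion> v 2) \<sqinter>
        (v (0 + 3) \<squnion> v 2) \<sqinter> (v (1 + 3) \<squnion> v 2)) ` {..<2}))"
    by (rule extends_eq, (rule extends_intros finite_lessThan finite_Diff finite_permutes_3
        permutes_3_nonempty lessThan_ne)+)
      (rule assms[unfolded identity_HS_def Let_def, rule_format, where bs = "\<lambda>i. v (i + 3)" for v])
  show ?thesis
    unfolding identity_HS_def Let_def
  proof (intro allI, goal_cases)
    case (1 a b c bs)
    define V where "V n = (if n = 0 then a else if n = 1 then b else if n = 2 then c else bs (n - 3))" for n :: nat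
    have V: "a = V 0" "b = V 1" "c = V 2" "bs i = V (i + 3)" for i by (simp_all add: V_def)
    show ?case unfolding V by (rule fun_cong[OF eq])
  qed
qed

section \<open>Maximal filters as minimal covers\<close>

lemma is_filter_Union_chain:
  assumes "\<C> \<noteq> {}" "subset.chain A \<C>" "\<And>F. F \<in> A \<Longrightarrow> is_filter F"
  shows "is_filter (\<Union>\<C>)"
proof -
  have fil: "is_filter F" if "F \<in> \<C>" for F using assms(2,3) that unfolding subset.chain_def by blast
  have "x \<sqinter> y \<in> \<Union>\<C>" if "x \<in> F" "F \<in> \<C>" "y \<in> G" "G \<in> \<C>" for x y F G
  proof -
    have "F \<subseteq> G \<or> G \<subseteq> F" using assms(2) that(2,4) unfolding subset.chain_def by blast
    then have "x \<sqinter> y \<in> F \<or> x \<sqinter> y \<in> G"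
      using fil[OF that(2)] fil[OF that(4)] that(1,3) unfolding is_filter_def by (meson subsetD)
    then show ?thesis using that(2,4) by blast
  qed
  then have "\<forall>x\<in>\<Union>\<C>. \<forall>y\<in>\<Union>\<C>. x \<sqinter> y \<in> \<Union>\<C>" by blast
  moreover have "\<forall>x\<in>\<Union>\<C>. \<forall>y. x \<le> y \<longrightarrow> y \<in> \<Union>\<C>" "\<Union>\<C> \<noteq> {}"
    using assms(1) fil unfolding is_filter_def by fast+
  ultimately show ?thesis unfolding is_filter_def by (intro conjI)
qed

text \<open>A smaller element is a larger filter, so a minimal \<open>x'\<close> is a maximal filter
  containing \<open>x\<close> whose intersection with \<open>y\<close> stays inside
  \<open>p\<close>. Both conditions pass to unions of chains.\<close>

lemma filt_minimal_cover:
  fixes p x y :: "'a::lattice filt"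
  assumes "p \<le> x \<squnion> y"
  shows "\<exists>x'\<le>x. p \<le> x' \<squnion> y \<and> (\<forall>z<x'. \<not> p \<le> z \<squnion> y)"
proof -
  define A where "A = {F. is_filter F \<and> filter_set x \<subseteq> F \<and> F \<inter> filter_set y \<subseteq> filter_set p}"
  have "filter_set x \<in> A"
    using assms filter_set[of x] unfolding A_def less_eq_filt_def filter_set_sup' by blast
  moreover have "\<Union>\<C> \<in> A" if "\<C> \<noteq> {}" "subset.chain A \<C>" for \<C>
  proof -
    have "is_filter (\<Union>\<C>)" using is_filter_Union_chain[OF that] unfolding A_def by blast
    moreover have "\<C> \<subseteq> A" using that(2) unfolding subset.chain_def by blast
    ultimately show ?thesis using that(1) unfolding A_def by blast
  qed
  ultimately obtain M where M: "M \<in> A" "\<forall>X\<in>A. M \<subseteq> X \<longrightarrow> X = M"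
    using subset_Zorn_nonempty[of A] by blast
  define x' where "x' = Abs_filt M"
  have x': "filter_set x' = M" using M(1) unfolding x'_def A_def by (simp add: Abs_filt_inverse)
  have "x' \<le> x" "p \<le> x' \<squnion> y"
    using M(1) unfolding less_eq_filt_def filter_set_sup' x' A_def by blast+
  moreover have "\<not> p \<le> z \<squnion> y" if "z < x'" for z
  proof
    assume "p \<le> z \<squnion> y"
    then have "filter_set z \<in> A"
      using that M(1) filter_set[of z] unfolding A_def less_eq_filt_def less_filt_def filter_set_sup' x' by blast
    then show False using M(2) that unfolding less_filt_def x' by blast
  qed
  ultimately show ?thesis by blast
qed

lemma seeded_lattice_filt:
  assumes "identity_HS TYPE('a::lattice)" "identity_U TYPE('a)" "identity_B TYPE('a)"
    "identity_E TYPE('a)" "identity_P TYPE('a)"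
  shows "seeded_lattice TYPE('a filt)"
  by unfold_locales
    (use assms filt_identity_HS filt_identity_U filt_identity_B filt_identity_E filt_identity_P
      filt_minimal_cover in blast)+

section \<open>Principal filters and join-irreducible filters\<close>

definition principal :: "'a::lattice \<Rightarrow> 'a filt" where "principal x = Abs_filt {z. x \<le> z}"

lemma filter_set_principal [simp]: "filter_set (principal x) = {z. x \<le> z}"
  unfolding principal_def
  by (rule Abs_filt_inverse) (auto simp: is_filter_def intro: order_trans)

lemma le_principal_iff: "F \<le> principal x \<longleftrightarrow> x \<in> filter_set F"
  unfolding less_eq_filt_def using filter_set_up by auto

lemma principal_le_iff [simp]: "principal x \<le> principal y \<longleftrightarrow> x \<le> y"
  by (simp add: le_principal_iff)

lemma principal_sup: "principal (x \<squnion> y) = principal x \<squnion> principal y"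
  by (auto simp: filter_set_inject[symmetric] filter_set_sup')

lemma principal_inf: "principal (x \<sqinter> y) = principal x \<sqinter> principal y"
  by (rule antisym) (auto simp: le_principal_iff filter_set_inf' less_eq_filt_def intro: order_trans inf_mono)

lemma principal_greatest: "greatest_of UNIV z \<Longrightarrow> F \<le> principal z"
  using filter_set_nonempty[of F] filter_set_up[of _ F z]
  unfolding le_principal_iff greatest_of_def by blast

text \<open>A filter containing the least element is improper, hence the least filter in the
  reversed order, which \<open>join_irreducibles\<close> excludes.\<close>

lemma principal_least: "least_of UNIV z \<Longrightarrow> p \<in> join_irreducibles \<Longrightarrow> \<not> p \<le> principal z"
proof
  assume "least_of UNIV z" "p \<in> join_irreducibles" "p \<le> principal z"
  then have "filter_set p = UNIV"
    using filter_set_up[of z p] unfolding le_principal_iff least_of_def by blast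
  then have "least_of UNIV p" unfolding least_of_def less_eq_filt_def by simp
  then show False using \<open>p \<in> join_irreducibles\<close> unfolding join_irreducibles_def by blast
qed

text \<open>Any member of the filter \<open>p\<close> meets \<open>q\<close> in a member of
  \<open>p\<close>. This is not the least element, so it is the atom \<open>q\<close>, and every
  member is above \<open>q\<close>.\<close>

lemma principal_atom:
  assumes q: "atom_of UNIV q" and p: "p \<in> join_irreducibles" "p \<le> principal q"
  shows "p = principal q"
proof -
  obtain z where z: "least_of UNIV z" "\<not> (\<exists>w. z < w \<and> w < q)"
    using q unfolding atom_of_def by auto
  have "q \<le> y" if "y \<in> filter_set p" for y
  proof -
    have "y \<sqinter> q \<in> filter_set p" using p(2) that filter_set_inf unfolding le_principal_iff by blast
    then have "y \<sqinter> q \<noteq> z" using principal_least[OF z(1) p(1)] unfolding le_principal_iff by blast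
    moreover have "z \<le> y \<sqinter> q" using z(1) unfolding least_of_def by blast
    ultimately have "z < y \<sqinter> q" unfolding less_le by metis
    then have "y \<sqinter> q = q" using z(2) order_le_less[of "y \<sqinter> q" q] by auto
    then show ?thesis by (simp add: le_iff_inf inf_commute)
  qed
  then have "principal q \<le> p" unfolding less_eq_filt_def by auto
  then show ?thesis using p(2) by (rule antisym[rotated])
qed

text \<open>Take a filter maximal among those containing \<open>x\<close> and avoiding
  \<open>y\<close>. If it is the intersection of two filters, one of these avoids \<open>y\<close>
  too and so equals it by maximality.\<close>

lemma join_irreducible_separation:
  assumes "\<not> x \<le> (y :: 'a::lattice)"
  obtains p where "p \<in> join_irreducibles" "p \<le> principal x" "\<not> p \<le> principal y"
proof -
  define A where "A = {F. is_filter F \<and> x \<in> F \<and> y \<notin> F}"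
  have "filter_set (principal x) \<in> A"
    using assms filter_set[of "principal x"] unfolding A_def by simp
  moreover have "\<Union>\<C> \<in> A" if "\<C> \<noteq> {}" "subset.chain A \<C>" for \<C>
  proof -
    have "is_filter (\<Union>\<C>)" using is_filter_Union_chain[OF that] unfolding A_def by blast
    moreover have "\<C> \<subseteq> A" using that(2) unfolding subset.chain_def by blast
    ultimately show ?thesis using that(1) unfolding A_def by blast
  qed
  ultimately obtain M where M: "M \<in> A" "\<forall>X\<in>A. M \<subseteq> X \<longrightarrow> X = M"
    using subset_Zorn_nonempty[of A] by blast
  define p where "p = Abs_filt M"
  have p: "filter_set p = M" using M(1) unfolding p_def A_def by (simp add: Abs_filt_inverse)
  have px: "p \<le> principal x" "\<not> p \<le> principal y" using M(1) unfolding le_principal_iff p A_def by blast+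
  have "p = u \<or> p = v" if "p = u \<squnion> v" for u v
  proof -
    have "M = filter_set u \<inter> filter_set v" using p unfolding that filter_set_sup' by simp
    then have "filter_set u = M \<or> filter_set v = M"
      using M filter_set[of u] filter_set[of v] unfolding A_def by blast
    then show ?thesis unfolding p[symmetric] filter_set_inject by blast
  qed
  moreover have "\<not> least_of UNIV p" using px(2) unfolding least_of_def by blast
  ultimately have "p \<in> join_irreducibles" unfolding join_irreducibles_def by blast
  with px that show thesis by blast
qed

lemma finite_principal:
  fixes F :: "'a::lattice filt"
  assumes "finite (UNIV :: 'a set)"
  obtains x where "F = principal x"
proof -
  have fin: "finite (filter_set F)" using assms by (rule finite_subset[rotated]) simp
  have "Inf_fin S \<in> filter_set F" if "finite S" "S \<noteq> {}" "S \<subseteq> filter_set F" for S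
    using that by (induction S rule: finite_ne_induct) (auto intro: filter_set_inf)
  then have "Inf_fin (filter_set F) \<in> filter_set F" using fin filter_set_nonempty by blast
  then have "filter_set F = filter_set (principal (Inf_fin (filter_set F)))"
    using filter_set_up Inf_fin.coboundedI[OF fin] by auto
  then show thesis using that unfolding filter_set_inject by blast
qed

lemma inj_principal: "inj principal"
  by (rule injI) (metis antisym order_refl principal_le_iff)

lemma join_irreducibles_finite:
  assumes "finite (UNIV :: 'a::lattice set)"
  shows "(join_irreducibles :: 'a::lattice filt set) = principal ` join_irreducibles"
proof -
  \<comment> \<open>Replaces the quantifiers over filters in the definition of join irreducibility
    by quantifiers over elements.\<close>
  have all: "(\<forall>F. P F) \<longleftrightarrow> (\<forall>x. P (principal x))" for P :: "'a filt \<Rightarrow> bool"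
    using finite_principal[OF assms] by metis
  have "principal x \<in> join_irreducibles \<longleftrightarrow> x \<in> join_irreducibles" for x :: 'a
    unfolding join_irreducibles_def least_of_def
    by (simp add: all principal_sup[symmetric] inj_eq[OF inj_principal])
  then show ?thesis
    unfolding set_eq_iff all by (simp add: inj_image_mem_iff[OF inj_principal])
qed

section \<open>Representation by coded chains of filters\<close>

lemma Co_join_cases: "z \<in> Co_join r X Y \<Longrightarrow> z \<in> X \<or> z \<in> Y \<or> (\<exists>u. (z, u) \<in> r)"
  unfolding Co_join_def by blast

lemma isLub_Co:
  assumes "linear_order_on T r" "X \<in> Co T r" "Y \<in> Co T r"
  shows "isLub (Co T r) {X, Y} (Co_join r X Y)"
  using Co_join_in_Co[OF assms] Co_join_least[OF assms(1)]
  unfolding isLub_def leastP_def isUb_def setle_def setge_def by (auto simp: Co_join_def)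

lemma isGlb_Co:
  assumes "X \<in> Co T r" "Y \<in> Co T r"
  shows "isGlb (Co T r) {X, Y} (X \<inter> Y)"
  using Co_inter[OF assms] unfolding isGlb_def greatestP_def isLb_def setle_def setge_def by auto

section \<open>Transport of chains and their convex sets along an injection\<close>

context
  fixes A :: "'s set" and r :: "'s rel" and e :: "'s \<Rightarrow> 't"
  assumes inj: "inj_on e A" and lin: "linear_order_on A r"
begin

lemma map_prod_image_iff:
  assumes "x \<in> A" "y \<in> A"
  shows "(e x, e y) \<in> map_prod e e ` r \<longleftrightarrow> (x, y) \<in> r"
proof
  assume "(e x, e y) \<in> map_prod e e ` r"
  then obtain a b where ab: "(a, b) \<in> r" "e x = e a" "e y = e b" by auto
  then have "a \<in> A" "b \<in> A" using linear_order_onD(1)[OF lin] by blast+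
  then show "(x, y) \<in> r" using ab inj_onD[OF inj ab(2)] inj_onD[OF inj ab(3)] assms by simp
qed force

lemma linear_order_on_image: "linear_order_on (e ` A) (map_prod e e ` r)"
proof -
  note r = linear_order_onD[OF lin]
  have "map_prod e e ` r \<subseteq> e ` A \<times> e ` A" using r(1) by auto
  moreover have "refl_on (e ` A) (map_prod e e ` r)"
    using r(2) by (auto intro!: refl_onI)
  moreover have "trans (map_prod e e ` r)"
  proof (rule transI)
    fix x y z assume *: "(x, y) \<in> map_prod e e ` r" "(y, z) \<in> map_prod e e ` r"
    then have "x \<in> e ` A" "y \<in> e ` A" "z \<in> e ` A" using r(1) by auto
    then obtain x' y' z' where "x = e x'" "y = e y'" "z = e z'" "x' \<in> A" "y' \<in> A" "z' \<in> A" by blast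
    with * show "(x, z) \<in> map_prod e e ` r" using r(3)[of x' y' z'] by (simp add: map_prod_image_iff)
  qed
  moreover have "antisym (map_prod e e ` r)"
  proof (rule antisymI)
    fix x y assume *: "(x, y) \<in> map_prod e e ` r" "(y, x) \<in> map_prod e e ` r"
    then have "x \<in> e ` A" "y \<in> e ` A" using r(1) by auto
    then obtain x' y' where "x = e x'" "y = e y'" "x' \<in> A" "y' \<in> A" by blast
    with * show "x = y" using r(4)[of x' y'] by (simp add: map_prod_image_iff)
  qed
  moreover have "total_on (e ` A) (map_prod e e ` r)"
    using r(5) by (intro total_onI) (auto simp: map_prod_image_iff)
  ultimately show ?thesis by (simp add: order_on_defs)
qed

lemma Co_image:
  assumes "X \<in> Co A r"
  shows "e ` X \<in> Co (e ` A) (map_prod e e ` r)"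
proof -
  have X: "x \<in> A" if "x \<in> X" for x using CoD(1)[OF assms] that by blast
  have *: "e z \<in> e ` X" if "x \<in> X" "y \<in> X" "z \<in> A" "(e x, e z) \<in> map_prod e e ` r" "(e z, e y) \<in> map_prod e e ` r"
    for x y z
    using that(4,5) CoD(2)[OF assms that(1-3)] unfolding map_prod_image_iff[OF X[OF that(1)] that(3)]
      map_prod_image_iff[OF that(3) X[OF that(2)]] by blast
  show ?thesis
    unfolding Co_def order_convex_def mem_Collect_eq
  proof (intro conjI ballI impI)
    show "e ` X \<subseteq> e ` A" using X by blast
    fix u v w assume uvw: "u \<in> e ` X" "v \<in> e ` X" "w \<in> e ` A"
      "(u, w) \<in> map_prod e e ` r \<and> (w, v) \<in> map_prod e e ` r"
    obtain x y z where "x \<in> X" "y \<in> X" "z \<in> A" "u = e x" "v = e y" "w = e z"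
      using uvw(1-3) by (elim imageE)
    with uvw(4) show "w \<in> e ` X" using *[of x y z] by simp
  qed
qed

lemma Co_join_image:
  assumes "X \<subseteq> A" "Y \<subseteq> A"
  shows "Co_join (map_prod e e ` r) (e ` X) (e ` Y) = e ` Co_join r X Y"
proof -
  let ?r = "map_prod e e ` r"
  have sub: "Co_join r X Y \<subseteq> A"
    using assms linear_order_onD(1)[OF lin] unfolding Co_join_def by blast
  have iff: "e z \<in> Co_join ?r (e ` X) (e ` Y) \<longleftrightarrow> z \<in> Co_join r X Y" if z: "z \<in> A" for z
  proof -
    have "e z \<in> e ` X \<longleftrightarrow> z \<in> X" "e z \<in> e ` Y \<longleftrightarrow> z \<in> Y"
      using inj_on_image_mem_iff[OF inj z] assms by blast+
    moreover have "(e u, e z) \<in> ?r \<longleftrightarrow> (u, z) \<in> r" "(e z, e u) \<in> ?r \<longleftrightarrow> (z, u) \<in> r"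
      if "u \<in> X \<or> u \<in> Y" for u
      using assms z that by (intro map_prod_image_iff; blast)+
    ultimately show ?thesis unfolding Co_join_def by simp
  qed
  show ?thesis
  proof (rule antisym; rule subsetI)
    fix w assume w: "w \<in> Co_join ?r (e ` X) (e ` Y)"
    from Co_join_cases[OF w] have "w \<in> e ` A" using assms linear_order_onD(1)[OF lin] by (elim disjE exE) auto
    then show "w \<in> e ` Co_join r X Y" using w iff by blast
  next
    fix w assume "w \<in> e ` Co_join r X Y"
    then obtain z where "z \<in> Co_join r X Y" "w = e z" by blast
    then show "w \<in> Co_join ?r (e ` X) (e ` Y)" using iff[of z] sub by blast
  qed
qed

end

lemma finite_linear_order_enum:
  assumes fin: "finite A" and lin: "linear_order_on A r"
  obtains g where "bij_betw g A {..<card A}" "\<And>x y. x \<in> A \<Longrightarrow> y \<in> A \<Longrightarrow> (x, y) \<in> r \<longleftrightarrow> g x \<le> g y"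
proof -
  note r = linear_order_onD[OF lin]
  define g where "g q = card {s. (s, q) \<in> r \<and> s \<noteq> q}" for q
  have sub: "{s. (s, q) \<in> r \<and> s \<noteq> q} \<subseteq> A - {q}" for q using r(1) by blast
  then have fin': "finite {s. (s, q) \<in> r \<and> s \<noteq> q}" for q
    using fin by (meson finite_Diff finite_subset)
  have less: "g x < g y" if "(x, y) \<in> r" "x \<noteq> y" for x y
    unfolding g_def using that r(3,4) by (intro psubset_card_mono fin') blast
  have iff: "(x, y) \<in> r \<longleftrightarrow> g x \<le> g y" if "x \<in> A" "y \<in> A" for x y
    using less[of x y] less[of y x] r(2)[of x] r(5)[of x y] that by (cases "x = y") auto
  have "inj_on g A"
    using iff r(4) by (intro inj_onI) (metis order_refl)
  moreover have "g ` A \<subseteq> {..<card A}"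
  proof
    fix n assume "n \<in> g ` A"
    then obtain q where "q \<in> A" "n = g q" by blast
    moreover have "{s. (s, q) \<in> r \<and> s \<noteq> q} \<subset> A" using sub[of q] \<open>q \<in> A\<close> by blast
    ultimately show "n \<in> {..<card A}" unfolding g_def using psubset_card_mono[OF fin] by simp
  qed
  ultimately have "bij_betw g A {..<card A}"
    unfolding bij_betw_def by (simp add: card_image card_subset_eq)
  then show thesis using iff that by blast
qed

lemma finite_lattice_least:
  assumes "finite (UNIV :: 'a::lattice set)"
  obtains z :: "'a::lattice" where "least_of UNIV z"
  using Inf_fin.coboundedI[OF assms] unfolding least_of_def by blast

section \<open>The family of coded chains\<close>

text \<open>Indices and points of the chains are both filters, hence subsets of \<open>'a\<close>.
  An injection of \<open>'a set\<close> into each parameter type is therefore enough to move the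
  whole family there.\<close>

locale coded_lattice =
  fixes index_code :: "'a::lattice set \<Rightarrow> 'i" and chain_code :: "'a set \<Rightarrow> 't"
  assumes inj_index_code: "inj index_code" and inj_chain_code: "inj chain_code"
    and identities: "identity_HS TYPE('a)" "identity_U TYPE('a)" "identity_B TYPE('a)"
      "identity_E TYPE('a)" "identity_P TYPE('a)"

sublocale coded_lattice \<subseteq> seeded_lattice "TYPE('a filt)"
  using identities by (rule seeded_lattice_filt)

context coded_lattice
begin

definition "icode p = index_code (filter_set p)"
definition "ccode p = chain_code (filter_set p)"
definition "chain i = ccode ` T (inv icode i)"
definition "chain_ord i = map_prod ccode ccode ` ord (inv icode i)"
text \<open>\<open>P\<close> is \<open>J\<close> for the general representation and a singleton for
  the subdirectly irreducible one. The value \<open>undefined\<close> off the index set makes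
  \<open>emb P x\<close> extensional, as membership in the product demands.\<close>

definition "emb P x i = (if i \<in> icode ` P then ccode ` rep (inv icode i) (principal x) else undefined)"

lemma inj_icode: "inj icode"
  by (rule injI) (simp add: icode_def inj_eq[OF inj_index_code] filter_set_inject)

lemma inj_ccode: "inj ccode"
  by (rule injI) (simp add: ccode_def inj_eq[OF inj_chain_code] filter_set_inject)

lemma inv_icode [simp]: "inv icode (icode p) = p"
  using inj_icode by simp

lemma emb_icode [simp]: "p \<in> P \<Longrightarrow> emb P x (icode p) = ccode ` rep p (principal x)"
  unfolding emb_def by simp

lemma rep_subset_T: "rep p x \<subseteq> T p" unfolding rep_def by blast

lemma chain_family_code: "chain_family I chain chain_ord"
  unfolding chain_family_def chain_def chain_ord_def
  using linear_order_on_image[OF inj_on_subset[OF inj_ccode subset_UNIV] linear_order_ord] by blast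

lemma emb_in_product: "emb P x \<in> Co_product (icode ` P) chain chain_ord"
  unfolding Co_product_def
proof (rule PiE_I)
  fix i assume "i \<in> icode ` P"
  then show "emb P x i \<in> Co (chain i) (chain_ord i)"
    unfolding chain_def chain_ord_def emb_def
    using Co_image[OF inj_on_subset[OF inj_ccode subset_UNIV] linear_order_ord rep_Co] by simp
qed (simp add: emb_def)

lemma lattice_embedding_emb:
  assumes P: "P \<subseteq> J" and sep: "\<And>x y. (\<And>p. p \<in> P \<Longrightarrow> rep p (principal x) = rep p (principal y)) \<Longrightarrow> x = y"
  shows "lattice_embedding (Co_product (icode ` P) chain chain_ord) (emb P)"
  unfolding lattice_embedding_Co_product_iff[OF chain_family_code]
proof (intro conjI ballI allI)
  show "inj (emb P)"
  proof (rule injI)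
    fix x y assume "emb P x = emb P y"
    then have "ccode ` rep p (principal x) = ccode ` rep p (principal y)" if "p \<in> P" for p
      using emb_icode[OF that] by metis
    then show "x = y" using sep by (simp add: inj_image_eq_iff[OF inj_ccode])
  qed
  show "range (emb P) \<subseteq> Co_product (icode ` P) chain chain_ord" using emb_in_product by blast
  fix i x y assume "i \<in> icode ` P"
  then obtain p where p: "p \<in> P" "i = icode p" by blast
  then have "p \<in> J" using P by blast
  show "emb P (x \<squnion> y) i = Co_join (chain_ord i) (emb P x i) (emb P y i)"
    using Co_join_image[OF inj_on_subset[OF inj_ccode subset_UNIV] linear_order_ord rep_subset_T rep_subset_T] p
    by (simp add: chain_ord_def principal_sup rep_sup[OF \<open>p \<in> J\<close>])
  show "emb P (x \<sqinter> y) i = emb P x i \<inter> emb P y i"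
    using p by (simp add: principal_inf rep_inf image_Int[OF inj_ccode])
qed

lemma rep_least: "least_of UNIV z \<Longrightarrow> p \<in> J \<Longrightarrow> rep p (principal z) = {}"
  using principal_least T_subset_J unfolding rep_def by blast

lemma preserves_existing_bounds_emb:
  assumes P: "P \<subseteq> J"
  shows "preserves_existing_bounds (Co_product (icode ` P) chain chain_ord) (emb P)"
  unfolding preserves_existing_bounds_def
proof (intro conjI allI impI)
  fix z :: 'a assume z: "least_of UNIV z"
  have "emb P z \<le> w" if "w \<in> Co_product (icode ` P) chain chain_ord" for w
    using rep_least[OF z] P unfolding Co_product_le_iff[OF emb_in_product that] by auto
  then show "least_of (Co_product (icode ` P) chain chain_ord) (emb P z)"
    unfolding least_of_def using emb_in_product by blast
next
  fix z :: 'a assume z: "greatest_of UNIV z"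
  have "w \<le> emb P z" if w: "w \<in> Co_product (icode ` P) chain chain_ord" for w
    unfolding Co_product_le_iff[OF w emb_in_product]
  proof
    fix i assume i: "i \<in> icode ` P"
    have "w i \<subseteq> chain i" using CoD(1)[OF Co_product_component[OF w i]] .
    also have "\<dots> = emb P z i"
      using i principal_greatest[OF z] unfolding chain_def emb_def rep_def by auto
    finally show "w i \<subseteq> emb P z i" .
  qed
  then show "greatest_of (Co_product (icode ` P) chain chain_ord) (emb P z)"
    unfolding greatest_of_def using emb_in_product by blast
qed

lemma rep_separates:
  assumes "\<And>p. p \<in> J \<Longrightarrow> rep p (principal x) = rep p (principal y)"
  shows "x = y"
proof -
  have "x \<le> y" if eq: "\<And>p. p \<in> J \<Longrightarrow> rep p (principal x) = rep p (principal y)" for x y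
  proof (rule ccontr)
    assume "\<not> x \<le> y"
    then obtain p where "p \<in> J" "p \<le> principal x" "\<not> p \<le> principal y"
      using join_irreducible_separation by blast
    then show False using eq[of p] unfolding rep_def T_def by blast
  qed
  from this[of x y] this[of y x] assms show ?thesis by (auto intro: antisym)
qed

text \<open>Some \<open>rep p\<close> separates a pair of distinct elements related by the least
  nontrivial congruence. The kernel of this \<open>rep p\<close> is a congruence that does not
  contain the least one, so it is equality.\<close>

lemma subdirectly_irreducible_rep:
  assumes "subdirectly_irreducible TYPE('a)"
  obtains p where "p \<in> J" "\<And>x y. rep p (principal x) = rep p (principal y) \<Longrightarrow> x = y"
proof -
  obtain \<theta> :: "('a \<times> 'a) set" where \<theta>: "lattice_congruence \<theta>" "\<theta> \<noteq> Id"
    "\<And>\<psi>. lattice_congruence \<psi> \<Longrightarrow> \<psi> \<noteq> Id \<Longrightarrow> \<theta> \<subseteq> \<psi>"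
    using assms unfolding subdirectly_irreducible_def by blast
  have "Id \<subseteq> \<theta>" using \<theta>(1) unfolding lattice_congruence_def equiv_def refl_on_def by auto
  then obtain x y where xy: "(x, y) \<in> \<theta>" "x \<noteq> y" using \<theta>(2) by auto
  then obtain p where p: "p \<in> J" "rep p (principal x) \<noteq> rep p (principal y)"
    using rep_separates by blast
  let ?\<psi> = "{(x, y). rep p (principal x) = rep p (principal y)}"
  have "equiv UNIV ?\<psi>"
    by (rule equivI) (auto simp: refl_on_def sym_def trans_def)
  then have "lattice_congruence ?\<psi>"
    unfolding lattice_congruence_def by (simp add: principal_sup principal_inf rep_sup[OF p(1)] rep_inf)
  then have "?\<psi> = Id" using \<theta>(3) xy(1) p(2) by blast
  then have "x = y" if "rep p (principal x) = rep p (principal y)" for x y using that by blast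
  with p(1) that show thesis by blast
qed

text \<open>The only join-irreducible filter below an atom is its own principal filter. The image is
  not empty, because the least element already has the empty image.\<close>

lemma rep_atom:
  assumes p: "p \<in> J" and inj: "\<And>x y. rep p (principal x) = rep p (principal y) \<Longrightarrow> x = y"
    and q: "atom_of UNIV q"
  shows "rep p (principal q) = {principal q}"
proof -
  have "rep p (principal q) \<subseteq> {principal q}"
    using principal_atom[OF q] T_subset_J[OF p] unfolding rep_def by blast
  moreover obtain z where z: "least_of UNIV z" "z < q" using q unfolding atom_of_def by blast
  moreover have "rep p (principal q) \<noteq> {}"
    using inj[of q z] rep_least[OF z(1) p] z(2) by auto
  ultimately show ?thesis by blast
qed

lemma atom_preserving_emb:
  assumes p: "p \<in> J" and inj: "\<And>x y. rep p (principal x) = rep p (principal y) \<Longrightarrow> x = y"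
  shows "atom_preserving (Co_product {icode p} chain chain_ord) (emb {p})"
  unfolding atom_preserving_def
proof (intro allI impI)
  fix q :: 'a assume q: "atom_of UNIV q"
  let ?C = "Co_product {icode p} chain chain_ord"
  have C: "emb {p} x \<in> ?C" for x using emb_in_product[of "{p}"] by simp
  obtain z :: 'a where z: "least_of UNIV z" using q unfolding atom_of_def by blast
  have least: "least_of ?C (emb {p} z)"
    using preserves_existing_bounds_emb[of "{p}"] p z unfolding preserves_existing_bounds_def by simp
  have eq: "emb {p} q (icode p) = {ccode (principal q)}" "emb {p} z (icode p) = {}"
    by (simp_all add: rep_atom[OF p inj q] rep_least[OF z p])
  have "w = emb {p} q \<or> w = emb {p} z" if w: "w \<in> ?C" and "w \<le> emb {p} q" for w
    using that(2) eq unfolding Co_product_le_iff[OF w C] Co_product_eq_iff[OF w C] by auto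
  moreover have "emb {p} z \<noteq> emb {p} q" using eq by (metis insert_not_empty)
  then have "emb {p} z < emb {p} q" using least C unfolding least_of_def by (simp add: less_le)
  ultimately show "atom_of ?C (emb {p} q)"
    using least C unfolding atom_of_def by (metis less_imp_le less_le)
qed

section \<open>Counting and isomorphism for finite lattices\<close>

lemma finite_J:
  assumes "finite (UNIV :: 'a set)"
  shows "finite J" "card J = card (join_irreducibles :: 'a set)"
  unfolding join_irreducibles_finite[OF assms]
  using assms by (auto simp: card_image[OF inj_on_subset[OF inj_principal subset_UNIV]] intro: finite_subset)

lemma finite_T:
  assumes "finite (UNIV :: 'a set)" "p \<in> J"
  shows "finite (T p)" "card (T p) \<le> card (join_irreducibles :: 'a set)"
  using finite_J[OF assms(1)] T_subset_J[OF assms(2)] finite_subset card_mono by metis+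

lemma card_chain [simp]: "finite (chain (icode p)) \<longleftrightarrow> finite (T p)" "card (chain (icode p)) = card (T p)"
  unfolding chain_def using inj_on_subset[OF inj_ccode subset_UNIV]
  by (simp_all add: card_image finite_image_iff)

text \<open>There are at most \<open>card J\<close> chains, and each \<open>T p\<close> is a subset
  of \<open>J\<close>.\<close>

lemma finite_sum_chains:
  assumes fin: "finite (UNIV :: 'a set)" and P: "P \<subseteq> J"
  shows "finite (SIGMA i:icode ` P. chain i)"
    "card (SIGMA i:icode ` P. chain i) \<le> (card (join_irreducibles :: 'a set))\<^sup>2"
proof -
  have finP: "finite P" using finite_J(1)[OF fin] P finite_subset by blast
  have chains: "finite (chain i) \<and> card (chain i) \<le> card (join_irreducibles :: 'a set)" if "i \<in> icode ` P" for i
    using that P finite_T[OF fin] by auto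
  then show "finite (SIGMA i:icode ` P. chain i)" using finP by blast
  have "card (SIGMA i:icode ` P. chain i) = (\<Sum>i\<in>icode ` P. card (chain i))"
    using chains finP by (intro card_SigmaI) auto
  also have "\<dots> \<le> card (icode ` P) * card (join_irreducibles :: 'a set)"
    using sum_bounded_above[of "icode ` P" "\<lambda>i. card (chain i)"] chains by simp
  also have "\<dots> \<le> card (join_irreducibles :: 'a set) * card (join_irreducibles :: 'a set)"
    using order_trans[OF card_image_le[OF finP] card_mono[OF finite_J(1)[OF fin] P]] finite_J(2)[OF fin]
    by (intro mult_right_mono) simp_all
  finally show "card (SIGMA i:icode ` P. chain i) \<le> (card (join_irreducibles :: 'a set))\<^sup>2"
    by (simp add: power2_eq_square)
qed

text \<open>
  A join-irreducible \<open>q\<close> outside \<open>T p\<close> would have the same image as the join of the elements of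
  \<open>T p\<close> below it.
\<close>

lemma T_eq_J:
  assumes fin: "finite (UNIV :: 'a set)" and p: "p \<in> J"
    and inj: "\<And>x y. rep p (principal x) = rep p (principal y) \<Longrightarrow> x = y"
  shows "T p = J"
proof
  show "J \<subseteq> T p"
  proof
    fix q assume q: "q \<in> J"
    let ?S = "rep p q"
    \<comment> \<open>The join of elements of \<open>T p\<close> is formed among filters. By
      finiteness every filter is principal, so injectivity extends to all filters.\<close>
    have inj': "u = v" if "rep p u = rep p v" for u v
      using finite_principal[OF fin] inj that by metis
    have finS: "finite ?S" using finite_T(1)[OF fin p] rep_subset_T finite_subset by blast
    \<comment> \<open>Were it empty, \<open>q\<close> would have the same image as each
      \<open>q \<sqinter> w\<close> and would thus be the least element.\<close>
    have "?S \<noteq> {}"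
    proof
      assume S: "?S = {}"
      then have "rep p (q \<sqinter> w) = rep p q" for w by (simp add: rep_inf)
      then have "q \<sqinter> w = q" for w using inj' by blast
      then have "q \<le> w" for w by (simp add: le_iff_inf)
      then show False using q unfolding join_irreducibles_def least_of_def by blast
    qed
    moreover have "rep p (Sup_fin ?S) = ?S"
    proof
      have "Sup_fin ?S \<le> q" by (rule Sup_fin.boundedI[OF finS \<open>?S \<noteq> {}\<close>]) (simp add: rep_def)
      then show "rep p (Sup_fin ?S) \<subseteq> ?S" unfolding rep_def by auto
      show "?S \<subseteq> rep p (Sup_fin ?S)"
        using Sup_fin.coboundedI[OF finS] unfolding rep_def by blast
    qed
    then have "q = Sup_fin ?S" using inj' by metis
    ultimately have "q \<in> ?S" using join_irreducible_Sup_fin[OF finS _ q] by blast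
    then show "q \<in> T p" unfolding rep_def by blast
  qed
qed (rule T_subset_J[OF p])

text \<open>By finiteness the element is a finite join of atoms, and irreducibility makes it one of
  them.\<close>

lemma atomistic_join_irreducible:
  assumes fin: "finite (UNIV :: 'a set)" and "atomistic TYPE('a)" and q: "q \<in> J"
  obtains x where "q = principal x" "atom_of UNIV x"
proof -
  obtain x where x: "q = principal x" "x \<in> join_irreducibles"
    using q unfolding join_irreducibles_finite[OF fin] by blast
  obtain A where A: "A \<subseteq> {p. atom_of UNIV p}" "isLub UNIV A x"
    using assms(2) unfolding atomistic_def by blast
  have finA: "finite A" by (rule finite_subset[OF subset_UNIV fin])
  have lub: "y \<le> x" if "y \<in> A" for y
    using A(2) that unfolding isLub_def leastP_def isUb_def setle_def by blast
  have least: "x \<le> u" if "\<And>y. y \<in> A \<Longrightarrow> y \<le> u" for u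
    using A(2) that unfolding isLub_def leastP_def isUb_def setle_def setge_def by blast
  have "A \<noteq> {}"
    using least x(2) unfolding join_irreducibles_def least_of_def by blast
  moreover have "x = Sup_fin A"
    using least[of "Sup_fin A"] Sup_fin.coboundedI[OF finA] Sup_fin.boundedI[OF finA \<open>A \<noteq> {}\<close> lub]
    by (intro antisym) auto
  ultimately have "x \<in> A" using join_irreducible_Sup_fin[OF finA _ x(2)] by blast
  with A(1) x(1) that show thesis by blast
qed

text \<open>Only surjectivity is new. All points of the chain are atoms, so all singletons are
  images, and a nonempty convex set of numbers is the join of the singletons of its minimum and
  maximum.\<close>

lemma atomistic_isomorphism:
  assumes fin: "finite (UNIV :: 'a set)" and atomistic: "atomistic TYPE('a)" and p: "p \<in> J"
    and inj: "\<And>x y. rep p (principal x) = rep p (principal y) \<Longrightarrow> x = y"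
  shows "\<exists>\<psi> :: 'a \<Rightarrow> nat set. lattice_isomorphism (Co_nat (card (join_irreducibles :: 'a set))) \<psi>"
proof -
  define n where "n = card (join_irreducibles :: 'a set)"
  have n: "card (T p) = n" using T_eq_J[OF fin p inj] finite_J(2)[OF fin] n_def by simp
  obtain g where g: "bij_betw g (T p) {..<n}"
    "\<And>x y. x \<in> T p \<Longrightarrow> y \<in> T p \<Longrightarrow> (x, y) \<in> ord p \<longleftrightarrow> g x \<le> g y"
    using finite_linear_order_enum[OF finite_T(1)[OF fin p] linear_order_ord] unfolding n by blast
  have inj_g: "inj_on g (T p)" and im: "g ` T p = {..<n}" using g(1) unfolding bij_betw_def by auto
  define R where "R = {(i, j). i \<le> j \<and> j < n}"
  have R: "R = map_prod g g ` ord p"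
  proof -
    have "(i, j) \<in> R \<longleftrightarrow> (i, j) \<in> map_prod g g ` ord p" for i j
    proof (cases "i < n \<and> j < n")
      case True
      then obtain x y where "i = g x" "j = g y" "x \<in> T p" "y \<in> T p" using im by (metis imageE lessThan_iff)
      then show ?thesis
        using map_prod_image_iff[OF inj_g linear_order_ord] g(2) True unfolding R_def by auto
    next
      \<comment> \<open>The two relations must agree as sets, since \<open>Co_nat\<close> fixes its
        relation; hence pairs outside the chain are checked as well.\<close>
      case False
      moreover have "map_prod g g ` ord p \<subseteq> {..<n} \<times> {..<n}"
        using linear_order_onD(1)[OF linear_order_ord[of p]] im by auto
      ultimately show ?thesis unfolding R_def by auto
    qed
    then show ?thesis by auto
  qed
  have Co: "Co_nat n = Co (g ` T p) (map_prod g g ` ord p)"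
    unfolding Co_nat_def im R_def[symmetric] R ..
  define \<psi> where "\<psi> x = g ` rep p (principal x)" for x
  have \<psi>_Co: "\<psi> x \<in> Co_nat n" for x
    unfolding \<psi>_def Co by (rule Co_image[OF inj_g linear_order_ord rep_Co])
  have \<psi>_sup: "\<psi> (x \<squnion> y) = Co_join R (\<psi> x) (\<psi> y)" for x y
    unfolding \<psi>_def R Co_join_image[OF inj_g linear_order_ord rep_subset_T rep_subset_T]
    by (simp add: principal_sup rep_sup[OF p])
  have \<psi>_inf: "\<psi> (x \<sqinter> y) = \<psi> x \<inter> \<psi> y" for x y
    unfolding \<psi>_def by (simp add: principal_inf rep_inf inj_on_image_Int[OF inj_g rep_subset_T rep_subset_T])
  have "inj \<psi>"
    by (rule injI) (use inj inj_on_image_eq_iff[OF inj_g rep_subset_T rep_subset_T] in \<open>simp add: \<psi>_def\<close>)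
  moreover have "isLub (Co_nat n) {\<psi> x, \<psi> y} (\<psi> (x \<squnion> y))" for x y
    using isLub_Co[OF linear_order_on_image[OF inj_g linear_order_ord]] \<psi>_Co
    unfolding Co \<psi>_sup R by blast
  moreover have "isGlb (Co_nat n) {\<psi> x, \<psi> y} (\<psi> (x \<sqinter> y))" for x y
    using isGlb_Co \<psi>_Co unfolding Co \<psi>_inf by blast
  moreover have "Z \<in> range \<psi>" if Z: "Z \<in> Co_nat n" for Z
  proof (cases "Z = {}")
    case True
    obtain z :: 'a where z: "least_of UNIV z" using finite_lattice_least[OF fin] .
    have "\<psi> z = Z" unfolding \<psi>_def True using rep_least[OF z p] by simp
    then show ?thesis by blast
  next
    case False
    have Z': "Z \<subseteq> {..<n}" "\<And>i j k. i \<in> Z \<Longrightarrow> k \<in> Z \<Longrightarrow> i \<le> j \<Longrightarrow> j \<le> k \<Longrightarrow> j \<in> Z"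
      using Z unfolding Co_nat_def Co_def order_convex_def by fastforce+
    then have finZ: "finite Z" using finite_subset by blast
    have point: "\<exists>x. \<psi> x = {i}" if "i \<in> Z" for i
    proof -
      obtain q where q: "q \<in> T p" "i = g q" using Z'(1) \<open>i \<in> Z\<close> im by blast
      then obtain x where "q = principal x" "atom_of UNIV x"
        using atomistic_join_irreducible[OF fin atomistic] T_subset_J[OF p] by blast
      then have "\<psi> x = {i}" unfolding \<psi>_def using rep_atom[OF p inj] q(2) by simp
      then show ?thesis ..
    qed
    obtain a b where ab: "a \<in> Z" "b \<in> Z" "\<And>i. i \<in> Z \<Longrightarrow> a \<le> i \<and> i \<le> b"
      using Min_in[OF finZ False] Max_in[OF finZ False] Min_le[OF finZ] Max_ge[OF finZ] by blast
    obtain x y where xy: "\<psi> x = {a}" "\<psi> y = {b}" using point ab(1,2) by blast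
    have "i \<in> Co_join R {a} {b} \<longleftrightarrow> i \<in> Z" for i
    proof -
      have "i \<in> Co_join R {a} {b} \<longleftrightarrow> i = a \<or> i = b \<or>
          a \<le> i \<and> i < n \<and> i \<le> b \<and> b < n \<or> b \<le> i \<and> i < n \<and> i \<le> a \<and> a < n"
        unfolding Co_join_def R_def by auto
      then show ?thesis using Z'(1) Z'(2)[OF ab(1,2), of i] Z'(2)[OF ab(2,1), of i] ab by blast
    qed
    then have "\<psi> (x \<squnion> y) = Z" unfolding \<psi>_sup xy by blast
    then show ?thesis by blast
  qed
  ultimately have "lattice_isomorphism (Co_nat n) \<psi>"
    using \<psi>_Co unfolding lattice_isomorphism_def lattice_embedding_def by blast
  then show ?thesis unfolding n_def by blast
qed

text \<open>In the subdirectly irreducible case a single \<open>p\<close> with injective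
  \<open>rep p\<close> indexes the family. Otherwise the clauses about subdirect irreducibility are
  vacuous and all of \<open>J\<close> is used.\<close>

lemma strong_representation:
  "\<exists>(I :: 'i set) (T :: 'i \<Rightarrow> 't set) (r :: 'i \<Rightarrow> 't rel) (\<phi> :: 'a \<Rightarrow> 'i \<Rightarrow> 't set).
    chain_family I T r \<and>
    lattice_embedding (Co_product I T r) \<phi> \<and>
    preserves_existing_bounds (Co_product I T r) \<phi> \<and>
    (finite (UNIV :: 'a set) \<longrightarrow>
      finite (SIGMA i:I. T i) \<and>
      card (SIGMA i:I. T i) \<le> (card (join_irreducibles :: 'a set))\<^sup>2) \<and>
    (subdirectly_irreducible TYPE('a) \<longrightarrow>
      (\<exists>i0. I = {i0} \<and>
        atom_preserving (Co_product I T r) \<phi> \<and>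
        (finite (UNIV :: 'a set) \<longrightarrow>
          finite (T i0) \<and> card (T i0) = card (join_irreducibles :: 'a set)))) \<and>
    (finite (UNIV :: 'a set) \<and> atomistic TYPE('a) \<and> subdirectly_irreducible TYPE('a) \<longrightarrow>
      (\<exists>\<psi> :: 'a \<Rightarrow> nat set.
        lattice_isomorphism (Co_nat (card (join_irreducibles :: 'a set))) \<psi>))"
proof (cases "subdirectly_irreducible TYPE('a)")
  case True
  then obtain p where p: "p \<in> J" and inj: "\<And>x y. rep p (principal x) = rep p (principal y) \<Longrightarrow> x = y"
    using subdirectly_irreducible_rep by blast
  have P: "{p} \<subseteq> J" "icode ` {p} = {icode p}" using p by auto
  show ?thesis
    using chain_family_code[of "{icode p}"] lattice_embedding_emb[OF P(1)] inj
      preserves_existing_bounds_emb[OF P(1)] finite_sum_chains[OF _ P(1)] atom_preserving_emb[OF p inj]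
      T_eq_J[OF _ p inj] finite_J atomistic_isomorphism[OF _ _ p inj] unfolding P(2)
    by (intro exI[of _ "{icode p}"] exI[of _ chain] exI[of _ chain_ord] exI[of _ "emb {p}"]) auto
next
  case False
  then show ?thesis
    using chain_family_code lattice_embedding_emb[OF order_refl rep_separates]
      preserves_existing_bounds_emb[OF order_refl] finite_sum_chains[OF _ order_refl]
    by (intro exI[of _ "icode ` J"] exI[of _ chain] exI[of _ chain_ord] exI[of _ "emb J"]) auto
qed

end

theorem theorem8p2:
  fixes index_code :: "'a::lattice set \<Rightarrow> 'i" and chain_code :: "'a set \<Rightarrow> 't"
  assumes index_type_large: "inj index_code" and chain_type_large: "inj chain_code"
  shows
    "(in_SUB_LO TYPE('a) TYPE('i) TYPE('t) \<longleftrightarrow>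
        identity_HS TYPE('a) \<and> identity_U TYPE('a) \<and> identity_B TYPE('a) \<and>
        identity_E TYPE('a) \<and> identity_P TYPE('a)) \<and>
     (in_SUB_LO TYPE('a) TYPE('i) TYPE('t) \<longleftrightarrow>
        (\<exists>(I :: 'i set) (T :: 'i \<Rightarrow> 't set) (r :: 'i \<Rightarrow> 't rel) (\<phi> :: 'a \<Rightarrow> 'i \<Rightarrow> 't set).
          chain_family I T r \<and>
          lattice_embedding (Co_product I T r) \<phi> \<and>
          preserves_existing_bounds (Co_product I T r) \<phi> \<and>
          (finite (UNIV :: 'a set) \<longrightarrow>
            finite (SIGMA i:I. T i) \<and>
            card (SIGMA i:I. T i) \<le> (card (join_irreducibles :: 'a set))\<^sup>2) \<and>
          (subdirectly_irreducible TYPE('a) \<longrightarrow>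
            (\<exists>i0. I = {i0} \<and>
              atom_preserving (Co_product I T r) \<phi> \<and>
              (finite (UNIV :: 'a set) \<longrightarrow>
                finite (T i0) \<and> card (T i0) = card (join_irreducibles :: 'a set)))) \<and>
          (finite (UNIV :: 'a set) \<and> atomistic TYPE('a) \<and> subdirectly_irreducible TYPE('a) \<longrightarrow>
            (\<exists>\<psi> :: 'a \<Rightarrow> nat set.
              lattice_isomorphism (Co_nat (card (join_irreducibles :: 'a set))) \<psi>))))"
    (is "(?SUB \<longleftrightarrow> ?identities) \<and> (?SUB \<longleftrightarrow> ?strong)")
proof -
  have "?SUB \<Longrightarrow> ?identities" by (rule in_SUB_LO_identities)
  moreover have "?strong" if ?identities
  proof -
    interpret coded_lattice index_code chain_code
      using assms that by unfold_locales blast+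
    show ?thesis by (rule strong_representation)
  qed
  moreover have "?strong \<Longrightarrow> ?SUB" unfolding in_SUB_LO_def by blast
  ultimately show ?thesis by blast
qed

end
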